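(* Let $q\ge1$, and let $\mathbf a=(a_1,\dots,a_q)$ and $\mathbf b=(b_1,\dots,b_q)$ have positive entries. If the Meijer $G$-function density $$\rho_{\mathbf a,\mathbf b}(s)=G^{q,0}_{q,q}\left(s\,\middle|\,\begin{matrix}\mathbf b\\ \mathbf a\end{matrix}\right)$$ is nonnegative on $(0,1)$, then for all $\delta>0$, $x>-1$ and real $\sigma$, $$-\operatorname{sgn}(\sigma)\,\partial_x\,\frac{{}_{q+1}F_q(\sigma,\mathbf a+\delta;\mathbf b+\delta;-x)}{{}_{q+1}F_q(\sigma,\mathbf a;\mathbf b;-x)}\ge0 .$$
   Context: $\mathbf a+\delta=(a_1+\delta,\dots,a_q+\delta)$, and similarly for $\mathbf b+\delta$; $\operatorname{sgn}$ is the sign function with $\operatorname{sgn}(0)=0$. ${}_{q+1}F_q(\sigma,\mathbf a;\mathbf b;y)$ is the generalised hypergeometric function, given for $|y|<1$ by $\sum_{n\ge0}\frac{(\sigma)_n\prod_i(a_i)_n}{\prod_i(b_i)_n}\frac{y^n}{n!}$, where $(c)_n=c(c+1)\cdots(c+n-1)$, and by analytic continuation to $\mathbb C\setminus[1,\infty)$; it is evaluated here at $y=-x<1$. For $0<s<1$, $$G^{q,0}_{q,q}\left(s\,\middle|\,\begin{matrix}\mathbf b\\ \mathbf a\end{matrix}\right)=\frac1{2\pi i}\int_{\mathcal L}\frac{\prod_{i=1}^q\Gamma(a_i+z)}{\prod_{i=1}^q\Gamma(b_i+z)}\,s^{-z}\,dz,$$ where $\mathcal L$ is a loop starting and ending at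 $-\infty$ and encircling all poles of $\prod_i\Gamma(a_i+z)$ once in the positive direction.
   Formalization: The formal theorem adds the hypothesis a_1+…+a_q ≤ b_1+…+b_q; without it the claim is false, e.g. q=1, a=2, b=1/2, where the density is positive on (0,1) but at x=0, δ=1 the stated quantity equals −2|σ|. *)

theory Defs
  imports "HOL-Complex_Analysis.Complex_Analysis"
begin

text \<open>Parameter tuples of length \<open>q\<close> are functions on \<open>{1..q}\<close>; values outside \<open>{1..q}\<close> are
  irrelevant.\<close>

definition hyp_series :: "nat \<Rightarrow> real \<Rightarrow> (nat \<Rightarrow> real) \<Rightarrow> (nat \<Rightarrow> real) \<Rightarrow> complex \<Rightarrow> complex" where
  "hyp_series q \<sigma> a b y =
     (\<Sum>n. of_real (pochhammer \<sigma> n * (\<Prod>i=1..q. pochhammer (a i) n)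
                     / (\<Prod>i=1..q. pochhammer (b i) n)) * y ^ n / fact n)"

definition cut_plane :: "complex set" where
  "cut_plane = - complex_of_real ` {1..}"

text \<open>The cut plane is open and connected, so two holomorphic continuations of the series agree on
  it and the choice below does not matter for \<open>y \<in> cut_plane\<close>.\<close>

definition hypergeometric ::
    "nat \<Rightarrow> real \<Rightarrow> (nat \<Rightarrow> real) \<Rightarrow> (nat \<Rightarrow> real) \<Rightarrow> complex \<Rightarrow> complex" where
  "hypergeometric q \<sigma> a b =
     (SOME F. F holomorphic_on cut_plane \<and> (\<forall>y. norm y < 1 \<longrightarrow> F y = hyp_series q \<sigma> a b y))"

text \<open>\<open>Gamma\<close> is \<open>0\<close> at its poles, so division by \<open>Gamma (b i + z)\<close> agrees with multiplication by the
  entire function \<open>rGamma (b i + z)\<close> at every \<open>z\<close>.\<close>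

definition meijer_integrand ::
    "nat \<Rightarrow> (nat \<Rightarrow> real) \<Rightarrow> (nat \<Rightarrow> real) \<Rightarrow> real \<Rightarrow> complex \<Rightarrow> complex" where
  "meijer_integrand q a b s z =
     (\<Prod>i=1..q. Gamma (of_real (a i) + z)) / (\<Prod>i=1..q. Gamma (of_real (b i) + z))
       * of_real s powr (- z)"

text \<open>The part of the loop with real part at least \<open>-R\<close>. The loop comes in from \<open>-\<infinity>\<close> below the real
  axis, crosses the axis at \<open>c\<close> and returns to \<open>-\<infinity>\<close> above it. It winds once, counterclockwise,
  around every point of the real axis to the left of \<open>c\<close>.\<close>

definition loop_path :: "real \<Rightarrow> real \<Rightarrow> real \<Rightarrow> complex" where
  "loop_path c R =
     linepath (Complex (- R) (- 1)) (Complex c (- 1)) +++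
     linepath (Complex c (- 1)) (Complex c 1) +++
     linepath (Complex c 1) (Complex (- R) 1)"

text \<open>The poles of \<open>\<Prod>i=1..q. Gamma (a i + z)\<close> are among the points \<open>- a i - k\<close> with \<open>k\<close> a natural number,
  all of which are smaller than \<open>1 - Min (a ` {1..q})\<close>. For \<open>0 < s < 1\<close> the integrand decays
  exponentially along both ends of the loop; by Cauchy's theorem any other loop of this kind gives the
  same value.\<close>

definition meijer_G :: "nat \<Rightarrow> (nat \<Rightarrow> real) \<Rightarrow> (nat \<Rightarrow> real) \<Rightarrow> real \<Rightarrow> complex" where
  "meijer_G q a b s =
     1 / (2 * of_real pi * \<i>) *
       Lim at_top (\<lambda>R. contour_integral (loop_path (1 - Min (a ` {1..q})) R) (meijer_integrand q a b s))"

end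

theory Submission
  imports Defs "HOL-Probability.Sinc_Integral"
begin

text \<open>
  Write \<open>\<Phi> z\<close> for the product of the quotients \<open>\<Gamma>(a\<^sub>i + z) / \<Gamma>(b\<^sub>i + z)\<close>. The \<open>G\<close>-function is an inverse
  Mellin transform of \<open>\<Phi>\<close>, so its density \<open>\<rho>\<close> should satisfy
  \<open>\<integral>\<^sub>0\<^sup>1 s\<^sup>p \<rho>(s) ds/s + \<kappa> = \<Phi> p\<close> for real \<open>p \<ge> 0\<close>, where \<open>\<kappa>\<close> is the limit of \<open>\<Phi>\<close> at \<open>+\<infinity>\<close>: it is \<open>1\<close> if
  the two parameter sums agree and \<open>0\<close> if the sum of the \<open>b\<^sub>i\<close> is larger. If \<open>\<rho> \<ge> 0\<close>, this says that
  \<open>\<rho>(s) ds/s\<close>, together with a point mass \<open>\<kappa>\<close> at \<open>1\<close>, is a finite positive measure \<open>\<mu>\<close> on \<open>(0,1]\<close>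
  with moments \<open>\<Phi> p\<close> (lemma \<open>mixing_measure\<close>).

  The coefficients of the hypergeometric series are the integer moments of \<open>\<mu>\<close> divided by \<open>\<Phi> 0\<close>, so the
  binomial series turns the hypergeometric function into
  \<open>\<integral> (1 - y s)\<^bsup>-\<sigma>\<^esup> d\<mu>(s) / \<Phi> 0\<close>, first for small \<open>y\<close> and then, by uniqueness of analytic continuation,
  on the whole cut plane (lemma \<open>hypergeometric_eq_power_mixture\<close>). Adding \<open>\<delta>\<close> to all parameters
  replaces \<open>\<mu>\<close> by \<open>s\<^sup>\<delta> \<mu>\<close>. With \<open>y = - x\<close>, the \<open>x\<close>-derivative of the quotient is therefore \<open>-\<sigma>\<close> times a positive
  constant times the covariance of \<open>s\<^sup>\<delta>\<close> and \<open>s / (1 + x s)\<close> under the probability measure proportional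
  to \<open>(1 + x s)\<^bsup>-\<sigma>\<^esup> \<mu>\<close>. Both functions increase with \<open>s\<close>, so by Chebyshev's inequality the covariance is
  nonnegative (lemma \<open>power_weighted_covariance\<close>).

  The work lies in the moments. Along the loop \<open>\<Phi>\<close> need not decay (it does not if the parameter
  sums agree), so the integrals cannot be exchanged when \<open>s\<^bsup>p-1\<^esup> \<rho>(s)\<close> is integrated directly. Testing against
  \<open>s\<^bsup>p-1\<^esup> (1 - s\<^sup>m)\<^sup>N\<close> instead produces an iterated difference of the Cauchy kernel \<open>1 / (p - z)\<close>, which decays
  like \<open>|z|\<^bsup>-N-1\<^esup>\<close>. Away from its poles \<open>\<Phi>\<close> grows at most polynomially, so for large \<open>N\<close> all integrals
  converge absolutely, and Fubini's theorem and residues give the moment as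
  \<open>\<Sum>\<^sub>k (-1)\<^sup>k (N choose k) \<Phi> (p + k m)\<close> (lemma \<open>meijer_G_difference_moment\<close>). As \<open>m\<close> tends to infinity, the
  left side converges monotonically because \<open>\<rho> \<ge> 0\<close>, while on the right the terms with \<open>k \<ge> 1\<close> tend to
  \<open>\<kappa>\<close> times an alternating binomial sum with value \<open>-1\<close>. So the polynomial growth of \<open>\<Phi>\<close> in the plane and
  its limit along the positive real axis suffice.
\<close>

section \<open>Growth of quotients of Gamma functions\<close>

text \<open>
  Gauss's limit formula for numerator and denominator at once, so that the factorials cancel.
\<close>
lemma gamma_quotient_LIMSEQ:
  fixes a b :: "'a :: Gamma"
  shows "(\<lambda>n. exp ((a - b) * of_real (ln (of_nat n))) * pochhammer b (n+1) / pochhammer a (n+1))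
     \<longlonglongrightarrow> Gamma a * rGamma b"
proof -
  have "(\<lambda>n. Gamma_series a n * rGamma_series b n) \<longlonglongrightarrow> Gamma a * rGamma b"
    by (intro tendsto_mult Gamma_series_LIMSEQ rGamma_series_LIMSEQ)
  moreover have "Gamma_series a n * rGamma_series b n =
      exp ((a - b) * of_real (ln (of_nat n))) * pochhammer b (n+1) / pochhammer a (n+1)" for n
    by (simp add: Gamma_series_def rGamma_series_def field_simps exp_diff)
  ultimately show ?thesis by simp
qed

text \<open>
  The \<open>k\<close>-th factor of Gauss's product is \<open>1 + (b - a) / (a + z + k)\<close>. Since \<open>b - a \<ge> 0\<close>, its modulus is
  at most its value at the leftmost real point \<open>z = c\<close>.
\<close>
lemma norm_Gamma_quotient_le:
  fixes a b c :: real
  assumes "a \<le> b" "0 < a + c" "c \<le> Re z"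
  shows "norm (Gamma (of_real a + z) * rGamma (of_real b + z)) \<le> Gamma (a + c) * rGamma (b + c)"
proof (rule LIMSEQ_le)
  let ?f = "\<lambda>n. exp ((of_real a + z - (of_real b + z)) * of_real (ln (of_nat n))) *
              pochhammer (of_real b + z) (n+1) / pochhammer (of_real a + z) (n+1)"
  let ?g = "\<lambda>n. exp ((a + c - (b + c)) * of_real (ln (of_nat n))) * pochhammer (b + c) (n+1) / pochhammer (a + c) (n+1)"
  show "(\<lambda>n. norm (?f n)) \<longlonglongrightarrow> norm (Gamma (of_real a + z) * rGamma (of_real b + z))"
    by (intro tendsto_norm gamma_quotient_LIMSEQ)
  show "?g \<longlonglongrightarrow> Gamma (a + c) * rGamma (b + c)"
    by (rule gamma_quotient_LIMSEQ)
  have fac: "norm ((of_real b + z + of_nat k) / (of_real a + z + of_nat k))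
       \<le> (b + c + real k) / (a + c + real k)" for k
  proof -
    define p where "p = a + Re z + real k"
    define r where "r = a + c + real k"
    define d where "d = b - a"
    have r: "0 < r" "r \<le> p" "0 \<le> d" using assms by (auto simp: p_def r_def d_def)
    have pos: "0 < norm (of_real a + z + of_nat k)"
    proof -
      have "p \<le> norm (of_real a + z + of_nat k)"
        using complex_Re_le_cmod[of "of_real a + z + of_nat k"] by (simp add: p_def)
      then show ?thesis using r by linarith
    qed
    have "norm (of_real b + z + of_nat k) = norm (of_real a + z + of_nat k + of_real d)"
      by (simp add: d_def ac_simps)
    also have "\<dots> \<le> norm (of_real a + z + of_nat k) + d"
      using norm_triangle_ineq[of "of_real a + z + of_nat k" "of_real d"] r by simp
    finally have "norm (of_real b + z + of_nat k) / norm (of_real a + z + of_nat k)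
       \<le> 1 + d / norm (of_real a + z + of_nat k)"
      using pos by (simp add: field_simps)
    also have "p \<le> norm (of_real a + z + of_nat k)"
      using complex_Re_le_cmod[of "of_real a + z + of_nat k"] by (simp add: p_def)
    then have "d / norm (of_real a + z + of_nat k) \<le> d / r"
      using r pos by (intro divide_left_mono mult_pos_pos) linarith+
    then have "1 + d / norm (of_real a + z + of_nat k) \<le> 1 + d / r" by simp
    also have "1 + d / r = (b + c + real k) / (a + c + real k)"
      using r by (simp add: field_simps r_def d_def)
    finally show ?thesis by (simp add: norm_divide)
  qed
  have "norm (?f n) \<le> ?g n" for n
  proof -
    have "norm (pochhammer (of_real b + z) (n+1) / pochhammer (of_real a + z) (n+1))
        = (\<Prod>k<n+1. norm ((of_real b + z + of_nat k) / (of_real a + z + of_nat k)))"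
      by (simp only: pochhammer_prod lessThan_atLeast0 norm_divide prod_norm[symmetric] prod_dividef)
    also have "\<dots> \<le> (\<Prod>k<n+1. (b + c + real k) / (a + c + real k))"
      by (intro prod_mono conjI fac) simp
    also have "\<dots> = pochhammer (b + c) (n+1) / pochhammer (a + c) (n+1)"
      by (simp add: pochhammer_prod lessThan_atLeast0 prod_dividef)
    finally have *: "norm (pochhammer (of_real b + z) (n+1) / pochhammer (of_real a + z) (n+1))
        \<le> pochhammer (b + c) (n+1) / pochhammer (a + c) (n+1)" .
    have "norm (?f n) = exp ((a - b) * ln (real n)) *
        norm (pochhammer (of_real b + z) (n+1) / pochhammer (of_real a + z) (n+1))"
      by (simp add: norm_mult norm_divide)
    also have "\<dots> \<le> exp ((a - b) * ln (real n)) * (pochhammer (b + c) (n+1) / pochhammer (a + c) (n+1))"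
      by (intro mult_left_mono *) simp
    finally show ?thesis by simp
  qed
  then show "\<exists>N. \<forall>n\<ge>N. norm (?f n) \<le> ?g n" by blast
qed

text \<open>
  The degree is hidden in the definition, so that such bounds multiply without bookkeeping.
\<close>
definition poly_bounded_on :: "complex set \<Rightarrow> (complex \<Rightarrow> complex) \<Rightarrow> bool" where
  "poly_bounded_on S f \<longleftrightarrow> (\<exists>C M. \<forall>z\<in>S. norm (f z) \<le> C * (1 + norm z) ^ M)"

lemma poly_bounded_onI: "(\<And>z. z \<in> S \<Longrightarrow> norm (f z) \<le> C * (1 + norm z) ^ M) \<Longrightarrow> poly_bounded_on S f"
  unfolding poly_bounded_on_def by blast

lemma poly_bounded_onE:
  assumes "poly_bounded_on S f"
  obtains C M where "C > 0" "\<forall>z\<in>S. norm (f z) \<le> C * (1 + norm z) ^ M"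
proof -
  from assms obtain C M where *: "\<And>z. z \<in> S \<Longrightarrow> norm (f z) \<le> C * (1 + norm z) ^ M"
    unfolding poly_bounded_on_def by blast
  show ?thesis
  proof (rule that)
    show "\<forall>z\<in>S. norm (f z) \<le> (\<bar>C\<bar> + 1) * (1 + norm z) ^ M"
      by (intro ballI order.trans[OF *] mult_right_mono) auto
  qed simp
qed

lemma poly_bounded_on_mult:
  assumes "poly_bounded_on S f" "poly_bounded_on S g"
  shows "poly_bounded_on S (\<lambda>z. f z * g z)"
proof -
  obtain C M where f: "C > 0" "\<forall>z\<in>S. norm (f z) \<le> C * (1 + norm z) ^ M"
    using assms(1) by (rule poly_bounded_onE)
  obtain D N where g: "D > 0" "\<forall>z\<in>S. norm (g z) \<le> D * (1 + norm z) ^ N"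
    using assms(2) by (rule poly_bounded_onE)
  show ?thesis
  proof (rule poly_bounded_onI)
    fix z assume "z \<in> S"
    then have "norm (f z) * norm (g z) \<le> (C * (1 + norm z) ^ M) * (D * (1 + norm z) ^ N)"
      using f g by (intro mult_mono) auto
    then show "norm (f z * g z) \<le> (C * D) * (1 + norm z) ^ (M + N)"
      by (simp add: norm_mult power_add mult_ac)
  qed
qed

lemma poly_bounded_on_subset: "poly_bounded_on S f \<Longrightarrow> T \<subseteq> S \<Longrightarrow> poly_bounded_on T f"
  unfolding poly_bounded_on_def by blast

lemma poly_bounded_on_Un:
  assumes "poly_bounded_on S f" "poly_bounded_on T f"
  shows "poly_bounded_on (S \<union> T) f"
proof -
  obtain C M where f: "C > 0" "\<forall>z\<in>S. norm (f z) \<le> C * (1 + norm z) ^ M"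
    using assms(1) by (rule poly_bounded_onE)
  obtain D N where g: "D > 0" "\<forall>z\<in>T. norm (f z) \<le> D * (1 + norm z) ^ N"
    using assms(2) by (rule poly_bounded_onE)
  show ?thesis
  proof (rule poly_bounded_onI)
    fix z assume z: "z \<in> S \<union> T"
    have 1: "C * (1 + norm z) ^ M \<le> (C + D) * (1 + norm z) ^ (M + N)"
      using f(1) g(1) by (intro mult_mono power_increasing) auto
    have 2: "D * (1 + norm z) ^ N \<le> (C + D) * (1 + norm z) ^ (M + N)"
      using f(1) g(1) by (intro mult_mono power_increasing) auto
    show "norm (f z) \<le> (C + D) * (1 + norm z) ^ (M + N)"
      using z f(2) g(2) 1 2 by auto
  qed
qed

lemma poly_bounded_on_cong:
  assumes "poly_bounded_on S f" "\<And>z. z \<in> S \<Longrightarrow> g z = f z"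
  shows "poly_bounded_on S g"
  using assms unfolding poly_bounded_on_def by simp

lemma poly_bounded_on_const: "poly_bounded_on S (\<lambda>_. k)"
  by (rule poly_bounded_onI[where C="norm k" and M=0]) simp

lemma poly_bounded_on_prod:
  "finite I \<Longrightarrow> (\<And>i. i \<in> I \<Longrightarrow> poly_bounded_on S (f i)) \<Longrightarrow> poly_bounded_on S (\<lambda>z. \<Prod>i\<in>I. f i z)"
  by (induction I rule: finite_induct) (auto intro!: poly_bounded_on_mult poly_bounded_on_const)

lemma poly_bounded_on_pochhammer: "poly_bounded_on S (\<lambda>z. pochhammer (w + z) m)"
proof -
  have "poly_bounded_on S (\<lambda>z. w + z + of_nat k)" for k
  proof (rule poly_bounded_onI)
    fix z
    have "norm (w + z + of_nat k) \<le> norm w + norm z + real k"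
      by (metis add_mono_thms_linordered_semiring(3) norm_triangle_ineq norm_of_nat order_trans)
    also have "\<dots> \<le> (1 + norm w + real k) * (1 + norm z) ^ 1"
      by (simp add: algebra_simps)
    finally show "norm (w + z + of_nat k) \<le> (1 + norm w + real k) * (1 + norm z) ^ 1" .
  qed
  then show ?thesis
    unfolding pochhammer_prod by (intro poly_bounded_on_prod) auto
qed

lemma poly_bounded_on_uminus:
  "poly_bounded_on (uminus ` S) f \<Longrightarrow> poly_bounded_on S (\<lambda>z. f (- z))"
  unfolding poly_bounded_on_def by fastforce

text \<open>
  Raising \<open>b\<close> by an integer costs only a polynomial factor, so \<open>a \<le> b\<close> may be assumed.
\<close>
lemma poly_bounded_Gamma_quotient_right:
  fixes a b c :: real
  assumes "0 < a + c"
  shows "poly_bounded_on {z. c \<le> Re z} (\<lambda>z. Gamma (of_real a + z) * rGamma (of_real b + z))"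
proof -
  obtain m :: nat where m: "a \<le> b + real m"
    using real_arch_simple[of "a - b"] by (auto simp: algebra_simps)
  have "poly_bounded_on {z. c \<le> Re z}
     (\<lambda>z. pochhammer (of_real b + z) m * (Gamma (of_real a + z) * rGamma (of_real (b + real m) + z)))"
  proof (rule poly_bounded_on_mult[OF poly_bounded_on_pochhammer])
    show "poly_bounded_on {z. c \<le> Re z} (\<lambda>z. Gamma (of_real a + z) * rGamma (of_real (b + real m) + z))"
      by (rule poly_bounded_onI[where M=0 and C="Gamma (a + c) * rGamma (b + real m + c)"])
        (use norm_Gamma_quotient_le[OF m assms] in auto)
  qed
  also have "(\<lambda>z. pochhammer (of_real b + z) m * (Gamma (of_real a + z) * rGamma (of_real (b + real m) + z)))
     = (\<lambda>z. Gamma (of_real a + z) * rGamma (of_real b + z))"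
    by (rule ext, subst (2) pochhammer_rGamma[of _ m]) (simp add: algebra_simps)
  finally show ?thesis .
qed

text \<open>
  With \<open>E = exp (2 \<pi> Im z)\<close>, the squared modulus of \<open>sin (\<pi> (t + z))\<close> differs from \<open>(E + 1/E) / 4\<close>
  by at most \<open>1/2\<close> for every real \<open>t\<close>, and \<open>E + 1/E\<close> is large when \<open>|Im z| \<ge> 1\<close>.
\<close>
lemma norm_sin_quotient_le:
  fixes u v :: real and z :: complex
  assumes "1 \<le> \<bar>Im z\<bar>"
  shows "sin (of_real pi * (of_real v + z)) \<noteq> 0"
    and "norm (sin (of_real pi * (of_real u + z)) / sin (of_real pi * (of_real v + z))) \<le> 2"
proof -
  define E where "E = exp (2 * (pi * Im z))"
  have E0: "E > 0" by (simp add: E_def)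
  have E: "E + inverse E \<ge> 4"
  proof (cases "Im z \<ge> 0")
    case True
    then have "1 + 2 * (pi * Im z) \<le> E" unfolding E_def by (intro exp_ge_add_one_self)
    moreover have "3 * 1 \<le> pi * Im z" using pi_gt3 True assms by (intro mult_mono) auto
    ultimately have "4 \<le> E" by linarith
    then show ?thesis using E0 by (simp add: add_increasing2)
  next
    case False
    have "1 + (- (2 * (pi * Im z))) \<le> inverse E" unfolding E_def exp_minus[symmetric] by (intro exp_ge_add_one_self)
    moreover have "3 * 1 \<le> pi * (- Im z)" using pi_gt3 False assms by (intro mult_mono) auto
    ultimately have "4 \<le> inverse E" by simp
    then show ?thesis using E0 by (simp add: add_increasing)
  qed
  have sq: "norm (sin (of_real pi * (of_real t + z)))^2
      = (E + inverse E - 2 * cos (2 * (pi * (t + Re z)))) / 4" for t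
    by (simp add: norm_sin_squared E_def exp_minus)
  have up: "norm (sin (of_real pi * (of_real u + z)))^2 \<le> (E + inverse E + 2) / 4"
    unfolding sq using cos_ge_minus_one[of "2 * (pi * (u + Re z))"] by (intro divide_right_mono) linarith+
  have lo: "(E + inverse E - 2) / 4 \<le> norm (sin (of_real pi * (of_real v + z)))^2"
    unfolding sq using cos_le_one[of "2 * (pi * (v + Re z))"] by (intro divide_right_mono) linarith+
  show nz: "sin (of_real pi * (of_real v + z)) \<noteq> 0"
    using lo E by auto
  have "norm (sin (of_real pi * (of_real u + z)))^2 \<le> (2 * norm (sin (of_real pi * (of_real v + z))))^2"
  proof -
    have "(2 * norm (sin (of_real pi * (of_real v + z))))^2 = 4 * norm (sin (of_real pi * (of_real v + z)))^2"
      by (simp add: power_mult_distrib)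
    moreover have "X \<le> 4 * Y" if "X \<le> (t + 2) / 4" "(t - 2) / 4 \<le> Y" "4 \<le> t" for X Y t :: real
      using that by (simp add: field_simps)
    ultimately show ?thesis using up lo E by metis
  qed
  then have "norm (sin (of_real pi * (of_real u + z))) \<le> 2 * norm (sin (of_real pi * (of_real v + z)))"
    by (rule power2_le_imp_le) simp
  then show "norm (sin (of_real pi * (of_real u + z)) / sin (of_real pi * (of_real v + z))) \<le> 2"
    using nz by (simp add: norm_divide field_simps)
qed

text \<open>
  To the left, the reflection formula turns the quotient into one whose arguments have bounded below
  real parts, times a bounded quotient of sines. An integer shift of the numerator brings the new
  quotient into the half-plane where the previous bound applies; the factors that it divides by
  have modulus at least \<open>1\<close> because their imaginary parts do.
\<close>
lemma poly_bounded_Gamma_quotient_off_axis: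
  fixes a b :: real
  shows "poly_bounded_on {z. 1 \<le> \<bar>Im z\<bar>} (\<lambda>z. Gamma (of_real a + z) * rGamma (of_real b + z))"
proof -
  define c where "c = 1 - a"
  define S where "S = {z::complex. 1 \<le> \<bar>Im z\<bar> \<and> Re z \<le> c}"
  define T where "T = {z::complex. 1 \<le> \<bar>Im z\<bar> \<and> - c \<le> Re z}"
  \<comment> \<open>The shift must make \<open>1 - b + m + w\<close> have positive real part whenever \<open>Re w \<ge> - c\<close>.\<close>
  obtain m :: nat where "c + b \<le> real m"
    using real_arch_simple by blast
  then have m: "0 < (1 - b + real m) + (- c)" by simp
  have T: "poly_bounded_on T (\<lambda>w. Gamma (of_real (1 - b) + w) * rGamma (of_real (1 - a) + w))"
  proof -
    have 1: "poly_bounded_on T (\<lambda>w. Gamma (of_real (1 - b + real m) + w) * rGamma (of_real (1 - a) + w))"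
      by (rule poly_bounded_on_subset[OF poly_bounded_Gamma_quotient_right[OF m]]) (auto simp: T_def)
    have 2: "poly_bounded_on T (\<lambda>w. inverse (pochhammer (of_real (1 - b) + w) m))"
    proof (rule poly_bounded_onI[where C=1 and M=0])
      fix w assume w: "w \<in> T"
      have "1 \<le> norm (of_real (1 - b) + w + of_nat k)" for k
        using abs_Im_le_cmod[of "of_real (1 - b) + w + of_nat k"] w by (auto simp: T_def)
      then have "1 \<le> norm (pochhammer (of_real (1 - b) + w) m)"
        unfolding pochhammer_prod prod_norm[symmetric] by (intro prod_ge_1) blast
      then show "norm (inverse (pochhammer (of_real (1 - b) + w) m)) \<le> 1 * (1 + norm w) ^ 0"
        by (simp add: norm_inverse inverse_le_1_iff)
    qed
    have eq: "Gamma (of_real (1 - b) + w) * rGamma (of_real (1 - a) + w) =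
        inverse (pochhammer (of_real (1 - b) + w) m) *
        (Gamma (of_real (1 - b + real m) + w) * rGamma (of_real (1 - a) + w))" if "w \<in> T" for w
    proof -
      have "rGamma (of_real (1 - b) + w) = pochhammer (of_real (1 - b) + w) m * rGamma (of_real (1 - b + real m) + w)"
        by (subst pochhammer_rGamma[of _ m]) (simp add: algebra_simps)
      then show ?thesis unfolding Gamma_def by simp
    qed
    show ?thesis
      by (rule poly_bounded_on_cong[OF poly_bounded_on_mult[OF 2 1] eq])
  qed
  have S: "poly_bounded_on S (\<lambda>z. Gamma (of_real a + z) * rGamma (of_real b + z))"
  proof -
    have "uminus ` S \<subseteq> T" by (auto simp: S_def T_def)
    then have 1: "poly_bounded_on S (\<lambda>z. Gamma (of_real (1 - b) - z) * rGamma (of_real (1 - a) - z))"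
      using poly_bounded_on_uminus[OF poly_bounded_on_subset[OF T]] by simp
    have 2: "poly_bounded_on S (\<lambda>z. sin (of_real pi * (of_real b + z)) / sin (of_real pi * (of_real a + z)))"
      by (rule poly_bounded_onI[where C=2 and M=0]) (auto simp: S_def norm_sin_quotient_le(2))
    have eq: "Gamma (of_real a + z) * rGamma (of_real b + z) =
       (Gamma (of_real (1 - b) - z) * rGamma (of_real (1 - a) - z)) *
       (sin (of_real pi * (of_real b + z)) / sin (of_real pi * (of_real a + z)))" if "z \<in> S" for z
    proof -
      have nz: "sin (of_real pi * (of_real t + z)) \<noteq> 0" for t
        using that norm_sin_quotient_le(1) by (auto simp: S_def)
      have A: "rGamma (of_real a + z) * rGamma (of_real (1 - a) - z) = sin (of_real pi * (of_real a + z)) / of_real pi"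
        using rGamma_reflection_complex[of "of_real a + z"] by (simp add: algebra_simps)
      have B: "rGamma (of_real b + z) * rGamma (of_real (1 - b) - z) = sin (of_real pi * (of_real b + z)) / of_real pi"
        using rGamma_reflection_complex[of "of_real b + z"] by (simp add: algebra_simps)
      have nzA: "rGamma (of_real a + z) \<noteq> 0" using A nz[of a] by auto
      have nzB: "rGamma (of_real (1 - b) - z) \<noteq> 0" using B nz[of b] by auto
      have A': "sin (of_real pi * (of_real a + z)) = of_real pi * rGamma (of_real a + z) * rGamma (of_real (1 - a) - z)"
        using A by (simp add: field_simps)
      have B': "sin (of_real pi * (of_real b + z)) = of_real pi * rGamma (of_real b + z) * rGamma (of_real (1 - b) - z)"
        using B by (simp add: field_simps)
      have nzC: "rGamma (of_real (1 - a) - z) \<noteq> 0" using A' nz[of a] by auto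
      show ?thesis unfolding A' B' Gamma_def using nzA nzB nzC by (simp add: field_simps)
    qed
    show ?thesis
      by (rule poly_bounded_on_cong[OF poly_bounded_on_mult[OF 1 2] eq])
  qed
  have "poly_bounded_on {z. c \<le> Re z} (\<lambda>z. Gamma (of_real a + z) * rGamma (of_real b + z))"
    by (rule poly_bounded_Gamma_quotient_right) (simp add: c_def)
  then show ?thesis
    by (rule poly_bounded_on_subset[OF poly_bounded_on_Un[OF S]]) (auto simp: S_def)
qed

text \<open>
  Overloaded, because its values at real arguments are the moments of the representing measure and
  its values at complex arguments form the Meijer integrand. Multiplication by \<open>rGamma\<close> makes
  its only singularities the poles of the numerator.
\<close>
definition gamma_ratio :: "nat \<Rightarrow> (nat \<Rightarrow> real) \<Rightarrow> (nat \<Rightarrow> real) \<Rightarrow> 'a :: Gamma \<Rightarrow> 'a" where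
  "gamma_ratio q a b z = (\<Prod>i=1..q. Gamma (of_real (a i) + z) * rGamma (of_real (b i) + z))"

lemma meijer_integrand_eq:
  "meijer_integrand q a b s z = gamma_ratio q a b z * of_real s powr (- z)"
  by (simp add: meijer_integrand_def gamma_ratio_def prod.distrib rGamma_inverse_Gamma prod_inversef[symmetric] divide_inverse)

lemma gamma_ratio_of_real: "gamma_ratio q a b (complex_of_real p) = of_real (gamma_ratio q a b p)"
  unfolding gamma_ratio_def of_real_prod of_real_mult
  by (intro prod.cong refl arg_cong2[where f="(*)"])
     (simp_all add: Gamma_complex_of_real rGamma_complex_of_real flip: of_real_add)

lemma gamma_ratio_shift:
  "gamma_ratio q (\<lambda>i. a i + \<delta>) (\<lambda>i. b i + \<delta>) z = gamma_ratio q a b (of_real \<delta> + z)"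
  by (simp add: gamma_ratio_def add.assoc)

lemma gamma_ratio_of_nat:
  fixes a b :: "nat \<Rightarrow> real"
  assumes "\<And>i. i \<in> {1..q} \<Longrightarrow> 0 < a i" "\<And>i. i \<in> {1..q} \<Longrightarrow> 0 < b i"
  shows "gamma_ratio q a b (real n) =
    gamma_ratio q a b 0 * ((\<Prod>i=1..q. pochhammer (a i) n) / (\<Prod>i=1..q. pochhammer (b i) n))"
proof -
  have "Gamma (a i + real n) * rGamma (b i + real n) =
      Gamma (a i) * rGamma (b i) * (pochhammer (a i) n / pochhammer (b i) n)" if i: "i \<in> {1..q}" for i
  proof -
    have "a i \<notin> \<int>\<^sub>\<le>\<^sub>0" "b i \<notin> \<int>\<^sub>\<le>\<^sub>0" using assms[OF i] by (auto elim!: nonpos_Ints_cases)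
    then have "pochhammer (a i) n = Gamma (a i + real n) / Gamma (a i)"
       "pochhammer (b i) n = Gamma (b i + real n) / Gamma (b i)"
      by (simp_all add: pochhammer_Gamma)
    then show ?thesis
      using Gamma_real_pos[OF assms(1)[OF i]] Gamma_real_pos[OF assms(2)[OF i]]
      by (simp add: rGamma_inverse_Gamma field_simps)
  qed
  then show ?thesis
    unfolding gamma_ratio_def by (simp add: prod.distrib prod_dividef)
qed

lemma gamma_ratio_pos:
  fixes a b :: "nat \<Rightarrow> real"
  assumes "\<And>i. i \<in> {1..q} \<Longrightarrow> 0 < a i + p" "\<And>i. i \<in> {1..q} \<Longrightarrow> 0 < b i + p"
  shows "0 < gamma_ratio q a b p"
  unfolding gamma_ratio_def using assms
  by (intro prod_pos) (simp add: rGamma_inverse_Gamma Gamma_real_pos)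

text \<open>
  Factor by factor, Gauss's limit shows that the ratio at \<open>p + n\<close> behaves like \<open>n\<close> to the power
  \<open>\<Sum> a\<^sub>i - \<Sum> b\<^sub>i\<close>. The limit will be the mass that the representing measure has at \<open>1\<close>.
\<close>
lemma gamma_ratio_tendsto:
  fixes a b :: "nat \<Rightarrow> real"
  assumes "\<And>i. i \<in> {1..q} \<Longrightarrow> 0 < a i" "\<And>i. i \<in> {1..q} \<Longrightarrow> 0 < b i" "0 \<le> p"
    and "(\<Sum>i=1..q. a i) \<le> (\<Sum>i=1..q. b i)"
  shows "(\<lambda>n. gamma_ratio q a b (p + real n)) \<longlonglongrightarrow>
    (if (\<Sum>i=1..q. a i) = (\<Sum>i=1..q. b i) then 1 else 0)"
proof -
  have fac: "(\<lambda>n. exp ((b i - a i) * ln (real n)) *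
      (Gamma (a i + (p + real (Suc n))) * rGamma (b i + (p + real (Suc n))))) \<longlonglongrightarrow> 1" if i: "i \<in> {1..q}" for i
  proof -
    define A where "A = a i + p"
    define B where "B = b i + p"
    have AB: "0 < A" "0 < B" using assms(1,2)[OF i] \<open>0 \<le> p\<close> by (auto simp: A_def B_def)
    have nz: "A \<notin> \<int>\<^sub>\<le>\<^sub>0" "B \<notin> \<int>\<^sub>\<le>\<^sub>0" using AB by (auto elim!: nonpos_Ints_cases)
    have G: "Gamma A > 0" "Gamma B > 0" using AB by simp_all
    have "(\<lambda>n. exp ((A - B) * ln (real n)) * pochhammer B (n+1) / pochhammer A (n+1)) \<longlonglongrightarrow> Gamma A * rGamma B"
      using gamma_quotient_LIMSEQ[of A B] by simp
    then have "(\<lambda>n. inverse (exp ((A - B) * ln (real n)) * pochhammer B (n+1) / pochhammer A (n+1))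
        * (Gamma A * rGamma B)) \<longlonglongrightarrow> inverse (Gamma A * rGamma B) * (Gamma A * rGamma B)"
      using G by (intro tendsto_intros) (auto simp: rGamma_inverse_Gamma)
    also have "inverse (Gamma A * rGamma B) * (Gamma A * rGamma B) = 1"
      using G by (simp add: rGamma_inverse_Gamma field_simps)
    also have "(\<lambda>n. inverse (exp ((A - B) * ln (real n)) * pochhammer B (n+1) / pochhammer A (n+1)) * (Gamma A * rGamma B))
       = (\<lambda>n. exp ((B - A) * ln (real n)) * (Gamma (A + real (Suc n)) * rGamma (B + real (Suc n))))"
    proof
      fix n
      have e: "inverse (exp ((A - B) * ln (real n))) = exp ((B - A) * ln (real n))"
        by (simp add: exp_minus[symmetric] algebra_simps)
      show "inverse (exp ((A - B) * ln (real n)) * pochhammer B (n+1) / pochhammer A (n+1)) * (Gamma A * rGamma B)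
       = exp ((B - A) * ln (real n)) * (Gamma (A + real (Suc n)) * rGamma (B + real (Suc n)))"
        unfolding pochhammer_Gamma[OF nz(1)] pochhammer_Gamma[OF nz(2)] divide_inverse inverse_mult_distrib e
        using G by (simp add: rGamma_inverse_Gamma field_simps)
    qed
    finally show ?thesis by (simp add: A_def B_def add.assoc)
  qed
  define \<psi> where "\<psi> = (\<Sum>i=1..q. b i - a i)"
  have \<psi>: "0 \<le> \<psi>" "\<psi> = (\<Sum>i=1..q. b i) - (\<Sum>i=1..q. a i)"
    using assms(4) by (simp_all add: \<psi>_def sum_subtractf)
  have "(\<lambda>n. \<Prod>i=1..q. exp ((b i - a i) * ln (real n)) *
      (Gamma (a i + (p + real (Suc n))) * rGamma (b i + (p + real (Suc n))))) \<longlonglongrightarrow> (\<Prod>i=1..q. 1)"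
    by (intro tendsto_prod fac)
  then have P: "(\<lambda>n. exp (\<psi> * ln (real n)) * gamma_ratio q a b (p + real (Suc n))) \<longlonglongrightarrow> 1"
    by (simp add: prod.distrib gamma_ratio_def \<psi>_def sum_distrib_right exp_sum)
  have Q: "(\<lambda>n. exp (- \<psi> * ln (real n))) \<longlonglongrightarrow> (if \<psi> = 0 then 1 else 0)"
  proof (cases "\<psi> = 0")
    case False
    then have "\<psi> > 0" using \<psi> by simp
    have "filterlim (\<lambda>n. ln (real n)) at_top sequentially"
      by (rule filterlim_compose[OF ln_at_top filterlim_real_sequentially])
    then have "filterlim (\<lambda>n. - \<psi> * ln (real n)) at_bot sequentially"
      using \<open>\<psi> > 0\<close> by (intro filterlim_tendsto_neg_mult_at_bot[OF tendsto_const]) auto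
    then show ?thesis using False by (auto intro: filterlim_compose[OF exp_at_bot])
  qed simp
  have "(\<lambda>n. exp (- \<psi> * ln (real n)) * (exp (\<psi> * ln (real n)) * gamma_ratio q a b (p + real (Suc n))))
     \<longlonglongrightarrow> (if \<psi> = 0 then 1 else 0) * 1"
    by (intro tendsto_mult P Q)
  then have "(\<lambda>n. gamma_ratio q a b (p + real (Suc n))) \<longlonglongrightarrow> (if \<psi> = 0 then 1 else 0)"
    by (simp add: mult.assoc[symmetric] exp_add[symmetric])
  then show ?thesis
    using \<psi>(2) by (subst (asm) filterlim_sequentially_Suc[of "\<lambda>n. gamma_ratio q a b (p + real n)"]) auto
qed

lemma gamma_ratio_holomorphic:
  assumes "\<And>i. i \<in> {1..q} \<Longrightarrow> \<alpha> \<le> a i"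
  shows "gamma_ratio q a b holomorphic_on {z. Im z \<noteq> 0 \<or> - \<alpha> < Re z}"
proof -
  have "of_real (a i) + z \<notin> \<int>\<^sub>\<le>\<^sub>0" if "i \<in> {1..q}" "Im z \<noteq> 0 \<or> - \<alpha> < Re z" for i z
    using assms[OF that(1)] that(2) by (auto elim!: nonpos_Ints_cases simp: complex_eq_iff)
  then show ?thesis
    unfolding gamma_ratio_def
    by (intro holomorphic_intros holomorphic_Gamma' holomorphic_rGamma') auto
qed

lemma gamma_ratio_poly_bounded:
  assumes "\<And>i. i \<in> {1..q} \<Longrightarrow> 0 < a i + c"
  shows "poly_bounded_on {z. c \<le> Re z \<or> 1 \<le> \<bar>Im z\<bar>} (gamma_ratio q a b)"
proof -
  have "poly_bounded_on ({z. c \<le> Re z} \<union> {z. 1 \<le> \<bar>Im z\<bar>}) (gamma_ratio q a b)"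
    unfolding gamma_ratio_def using assms
    by (intro poly_bounded_on_prod poly_bounded_on_Un poly_bounded_Gamma_quotient_right
         poly_bounded_Gamma_quotient_off_axis) auto
  then show ?thesis by (rule poly_bounded_on_subset) auto
qed

section \<open>Iterated differences of the Cauchy kernel\<close>

text \<open>
  The result of applying \<open>f \<mapsto> (\<lambda>w. f w - f (w + m))\<close> to \<open>\<lambda>w. 1 / w\<close> a total of \<open>N\<close> times.
\<close>
definition diff_kernel :: "nat \<Rightarrow> nat \<Rightarrow> 'a :: field_char_0 \<Rightarrow> 'a" where
  "diff_kernel N m w = (\<Sum>k\<le>N. (-1) ^ k * of_nat (N choose k) / (w + of_nat (k * m)))"

text \<open>
  Pascal's rule: one more difference is the difference of two shifted differences.
\<close>
lemma alternating_binomial_sum_Suc: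
  fixes g :: "nat \<Rightarrow> 'a :: comm_ring_1"
  shows "(\<Sum>k\<le>Suc N. (-1) ^ k * of_nat (Suc N choose k) * g k) =
    (\<Sum>k\<le>N. (-1) ^ k * of_nat (N choose k) * g k) - (\<Sum>k\<le>N. (-1) ^ k * of_nat (N choose k) * g (Suc k))"
proof -
  have "(\<Sum>k\<le>Suc N. (-1) ^ k * of_nat (Suc N choose k) * g k) =
     g 0 + (\<Sum>k\<le>N. (-1) ^ Suc k * of_nat (Suc N choose Suc k) * g (Suc k))"
    by (subst sum.atMost_Suc_shift) simp
  also have "(\<Sum>k\<le>N. (-1) ^ Suc k * of_nat (Suc N choose Suc k) * g (Suc k)) =
     (\<Sum>k\<le>N. (-1) ^ Suc k * of_nat (N choose Suc k) * g (Suc k)) -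
     (\<Sum>k\<le>N. (-1) ^ k * of_nat (N choose k) * g (Suc k))"
    unfolding sum_subtractf[symmetric] by (intro sum.cong refl) (simp add: algebra_simps)
  also have "g 0 + ((\<Sum>k\<le>N. (-1) ^ Suc k * of_nat (N choose Suc k) * g (Suc k)) -
     (\<Sum>k\<le>N. (-1) ^ k * of_nat (N choose k) * g (Suc k))) =
     (g 0 + (\<Sum>k\<le>N. (-1) ^ Suc k * of_nat (N choose Suc k) * g (Suc k))) -
     (\<Sum>k\<le>N. (-1) ^ k * of_nat (N choose k) * g (Suc k))" by simp
  also have "g 0 + (\<Sum>k\<le>N. (-1) ^ Suc k * of_nat (N choose Suc k) * g (Suc k)) =
     (\<Sum>k\<le>Suc N. (-1) ^ k * of_nat (N choose k) * g k)"
    by (subst sum.atMost_Suc_shift) simp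
  also have "\<dots> = (\<Sum>k\<le>N. (-1) ^ k * of_nat (N choose k) * g k)"
    by (simp add: binomial_eq_0)
  finally show ?thesis .
qed

text \<open>
  Each difference gains one factor in the denominator, hence one order of decay.
\<close>
lemma diff_kernel_eq:
  fixes w :: "'a :: field_char_0"
  assumes "\<And>k. k \<le> N \<Longrightarrow> w + of_nat (k * m) \<noteq> 0"
  shows "diff_kernel N m w = of_nat m ^ N * fact N / (\<Prod>k\<le>N. w + of_nat (k * m))"
  using assms
proof (induction N arbitrary: w)
  case 0
  then show ?case by (simp add: diff_kernel_def)
next
  case (Suc N)
  let ?P = "\<Prod>k\<le>N. w + of_nat (k * m)" and ?Q = "\<Prod>k\<le>N. (w + of_nat m) + of_nat (k * m)"
  have shift: "(w + of_nat m) + of_nat (k * m) = w + of_nat (Suc k * m)" for k by simp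
  have nz: "w + of_nat (k * m) \<noteq> 0" if "k \<le> Suc N" for k using Suc.prems that by blast
  have nz': "(w + of_nat m) + of_nat (k * m) \<noteq> 0" if "k \<le> N" for k
    unfolding shift by (rule nz) (use that in simp)
  have "diff_kernel (Suc N) m w = diff_kernel N m w - diff_kernel N m (w + of_nat m)"
    unfolding diff_kernel_def
    using alternating_binomial_sum_Suc[of N "\<lambda>k. inverse (w + of_nat (k * m))"]
    by (simp add: divide_inverse add.assoc)
  also have "diff_kernel N m w = of_nat m ^ N * fact N / ?P"
    by (rule Suc.IH) (use nz in auto)
  also have "diff_kernel N m (w + of_nat m) = of_nat m ^ N * fact N / ?Q"
    by (rule Suc.IH) (use nz' in auto)
  also have "of_nat m ^ N * fact N / ?P - of_nat m ^ N * fact N / ?Q =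
      of_nat m ^ Suc N * fact (Suc N) / (\<Prod>k\<le>Suc N. w + of_nat (k * m))"
  proof -
    define R where "R = (\<Prod>k\<le>Suc N. w + of_nat (k * m))"
    define l where "l = w + of_nat (Suc N * m)"
    have R1: "R = ?P * l" by (simp add: R_def l_def algebra_simps)
    have R2: "R = w * ?Q" unfolding R_def shift by (subst prod.atMost_Suc_shift) simp
    have nzs: "?P \<noteq> 0" "?Q \<noteq> 0" "w \<noteq> 0" "l \<noteq> 0"
      using nz nz' nz[of 0] nz[of "Suc N"] by (auto simp: l_def)
    have cancel: "1 / x = y / (x * y)" if "y \<noteq> 0" for x y :: 'a
      using that by simp
    have "1 / ?P = l / R" unfolding R1 by (rule cancel) fact
    moreover have "1 / ?Q = w / R" unfolding R2 mult.commute[of w] by (rule cancel) fact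
    ultimately have "of_nat m ^ N * fact N / ?P - of_nat m ^ N * fact N / ?Q = of_nat m ^ N * fact N * (l - w) / R"
      by (simp add: divide_inverse algebra_simps)
    also have "l - w = of_nat (Suc N) * of_nat m" by (simp add: l_def algebra_simps)
    finally show ?thesis unfolding R_def by (simp add: mult_ac)
  qed
  finally show ?case .
qed

lemma power_integrand_tendsto_0:
  assumes "0 < Re w"
  shows "((\<lambda>s. exp (w * of_real (ln s))) \<longlongrightarrow> 0) (at_right 0)"
proof (rule tendsto_norm_zero_cancel)
  have "filterlim (\<lambda>s. Re w * ln s) at_bot (at_right 0)"
    using assms by (intro filterlim_tendsto_pos_mult_at_bot[OF tendsto_const _ ln_at_0]) auto
  then show "((\<lambda>s. norm (exp (w * of_real (ln s)))) \<longlongrightarrow> 0) (at_right 0)"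
    by (simp add: filterlim_compose[OF exp_at_bot])
qed

text \<open>
  For real exponents the fundamental theorem of calculus yields integrability along with the value,
  because the integrand is nonnegative; this provides the majorant for complex exponents.
\<close>
lemma has_bochner_integral_power_unit_interval:
  fixes w :: complex
  assumes "0 < Re w"
  shows "has_bochner_integral lborel
    (\<lambda>s. indicator {0<..<1} s *\<^sub>R exp ((w - 1) * of_real (ln s))) (1 / w)"
proof -
  have w: "w \<noteq> 0" using assms by auto
  have der: "((\<lambda>s. exp (v * of_real (ln s)) / v) has_vector_derivative exp ((v - 1) * of_real (ln x))) (at x)"
    if "0 < x" "v \<noteq> 0" for x :: real and v :: complex
  proof -
    have "((\<lambda>s. complex_of_real (ln s)) has_vector_derivative of_real (1 / x)) (at x)"
      using that by (intro has_vector_derivative_of_real) (auto intro!: derivative_eq_intros)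
    moreover have "((\<lambda>u. exp (v * u) / v) has_field_derivative exp (v * of_real (ln x))) (at (of_real (ln x)))"
      using that by (auto intro!: derivative_eq_intros)
    ultimately have "((\<lambda>s. exp (v * of_real (ln s)) / v) has_vector_derivative
       (of_real (1 / x) * exp (v * of_real (ln x)))) (at x)"
      by (auto dest: field_vector_diff_chain_at simp: o_def)
    moreover have "exp ((v - 1) * of_real (ln x)) = exp (v * of_real (ln x)) * of_real (1 / x)"
      using that by (simp add: algebra_simps exp_diff exp_of_real)
    ultimately show ?thesis by (simp only: mult.commute)
  qed
  have lim1: "((\<lambda>s. exp (v * of_real (ln s)) / v) \<longlongrightarrow> 1 / v) (at_left 1)" if "v \<noteq> 0" for v :: complex
  proof -
    have "isCont (\<lambda>s. exp (v * of_real (ln s)) / v) 1" using that by (intro continuous_intros) auto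
    then show ?thesis by (simp add: continuous_within filterlim_at_split)
  qed
  have cont: "isCont (\<lambda>s. exp ((v - 1) * of_real (ln s))) x" if "0 < x" for x :: real and v :: complex
    using that by (intro continuous_intros) auto
  let ?r = "Re w"
  have "set_integrable lborel (einterval (ereal 0) (ereal 1)) (\<lambda>s. exp ((?r - 1) * ln s))"
  proof (rule interval_integral_FTC_nonneg(1))
    show "((\<lambda>s. exp (?r * ln s) / ?r) has_real_derivative exp ((?r - 1) * ln x)) (at x)"
      if "ereal 0 < ereal x" "ereal x < ereal 1" for x
      using that assms by (auto intro!: derivative_eq_intros simp: algebra_simps exp_diff)
    show "isCont (\<lambda>s. exp ((?r - 1) * ln s)) x" if "ereal 0 < ereal x" "ereal x < ereal 1" for x
      using that by (intro continuous_intros) auto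
    have "((\<lambda>s. Re (exp (of_real ?r * of_real (ln s))) / ?r) \<longlongrightarrow> Re 0 / ?r) (at_right 0)"
      using power_integrand_tendsto_0[of "of_real ?r"] assms by (intro tendsto_intros) auto
    then show "(((\<lambda>s. exp (?r * ln s) / ?r) \<circ> real_of_ereal) \<longlongrightarrow> 0) (at_right (ereal 0))"
      unfolding ereal_tendsto_simps by (simp add: Re_exp)
    have "isCont (\<lambda>s. exp (?r * ln s) / ?r) 1" using assms by (intro continuous_intros) auto
    then show "(((\<lambda>s. exp (?r * ln s) / ?r) \<circ> real_of_ereal) \<longlongrightarrow> 1 / ?r) (at_left (ereal 1))"
      unfolding ereal_tendsto_simps by (simp add: continuous_within filterlim_at_split)
  qed simp_all
  then have "integrable lborel (\<lambda>s. indicator {0<..<1} s *\<^sub>R exp ((?r - 1) * ln s))"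
    by (simp add: set_integrable_def)
  then have int: "integrable lborel (\<lambda>s. indicator {0<..<1} s *\<^sub>R exp ((w - 1) * of_real (ln s)))"
    by (rule Bochner_Integration.integrable_bound) (auto split: split_indicator)
  have "(LBINT s=ereal 0..ereal 1. exp ((w - 1) * of_real (ln s))) = 1 / w - 0"
  proof (rule interval_integral_FTC_integrable)
    show "set_integrable lborel (einterval (ereal 0) (ereal 1)) (\<lambda>s. exp ((w - 1) * of_real (ln s)))"
      using int by (simp add: set_integrable_def)
    have "((\<lambda>s. exp (w * of_real (ln s)) / w) \<longlongrightarrow> 0 / w) (at_right 0)"
      using power_integrand_tendsto_0[OF assms] w by (intro tendsto_intros)
    then show "(((\<lambda>s. exp (w * of_real (ln s)) / w) \<circ> real_of_ereal) \<longlongrightarrow> 0) (at_right (ereal 0))"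
      unfolding ereal_tendsto_simps by simp
    show "(((\<lambda>s. exp (w * of_real (ln s)) / w) \<circ> real_of_ereal) \<longlongrightarrow> 1 / w) (at_left (ereal 1))"
      unfolding ereal_tendsto_simps by (rule lim1[OF w])
  qed (use der[OF _ w] cont in auto)
  then show ?thesis
    using int by (simp add: has_bochner_integral_iff interval_lebesgue_integral_def set_lebesgue_integral_def)
qed

text \<open>
  The iterated difference is the Mellin transform of \<open>(1 - s\<^sup>m)\<^sup>N\<close> on \<open>(0,1)\<close>, since \<open>1 / (w + k m)\<close> is that
  of \<open>s\<^bsup>k m\<^esup>\<close>.
\<close>
lemma has_bochner_integral_diff_kernel:
  fixes w :: complex
  assumes "0 < Re w"
  shows "has_bochner_integral lborel
    (\<lambda>s. (indicator {0<..<1} s * (1 - s ^ m) ^ N) *\<^sub>R exp ((w - 1) * of_real (ln s))) (diff_kernel N m w)"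
proof -
  have "has_bochner_integral lborel
    (\<lambda>s. \<Sum>k\<le>N. ((-1) ^ k * of_nat (N choose k)) * (indicator {0<..<1} s *\<^sub>R exp ((w + of_nat (k * m) - 1) * of_real (ln s))))
    (\<Sum>k\<le>N. ((-1) ^ k * of_nat (N choose k)) * (1 / (w + of_nat (k * m))))"
    by (intro has_bochner_integral_sum has_bochner_integral_mult_right
         has_bochner_integral_power_unit_interval)
       (use assms in \<open>simp add: add_pos_nonneg\<close>)
  moreover have "(\<Sum>k\<le>N. ((-1) ^ k * of_nat (N choose k)) * (indicator {0<..<1} s *\<^sub>R exp ((w + of_nat (k * m) - 1) * of_real (ln s))))
     = (indicator {0<..<1} s * (1 - s ^ m) ^ N) *\<^sub>R exp ((w - 1) * of_real (ln s))" for s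
  proof (cases "s \<in> {0<..<1}")
    case True
    have e: "exp ((w + of_nat (k * m) - 1) * of_real (ln s)) = of_real (s ^ m) ^ k * exp ((w - 1) * of_real (ln s))" for k
    proof -
      have "exp (of_nat (k * m) * of_real (ln s)) = exp (complex_of_real (ln s)) ^ (k * m)"
        by (rule exp_of_nat_mult)
      also have "exp (complex_of_real (ln s)) = of_real s" using True by (simp add: exp_of_real)
      finally have "exp (of_nat (k * m) * complex_of_real (ln s)) = of_real (s ^ m) ^ k"
        by (simp add: power_mult[symmetric] mult.commute)
      then show ?thesis by (simp add: algebra_simps exp_add[symmetric] exp_diff exp_add)
    qed
    have "(1 - of_real (s ^ m)) ^ N = (\<Sum>k\<le>N. of_nat (N choose k) * (- of_real (s ^ m)) ^ k :: complex)"
      using binomial_ring[of "- of_real (s ^ m)" "1 :: complex" N] by simp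
    also have "\<dots> = (\<Sum>k\<le>N. (-1) ^ k * of_nat (N choose k) * of_real (s ^ m) ^ k)"
      by (intro sum.cong refl) (metis (no_types) mult.assoc mult.commute power_minus)
    finally have b: "(1 - of_real (s ^ m)) ^ N = (\<Sum>k\<le>N. (-1) ^ k * of_nat (N choose k) * of_real (s ^ m) ^ k :: complex)" .
    show ?thesis using True unfolding e by (simp add: b[simplified] scaleR_conv_of_real sum_distrib_right mult.assoc)
  qed simp
  ultimately show ?thesis by (simp add: diff_kernel_def)
qed

section \<open>Integration along the loop\<close>

text \<open>
  The untruncated loop parametrised by arc length, with \<open>u = 0\<close> on the real axis. This makes a loop
  integral a single Lebesgue integral over the real line, to which Fubini's theorem applies.
\<close>
definition loop_point :: "real \<Rightarrow> real \<Rightarrow> complex" where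
  "loop_point c u = Complex (c - max 0 (\<bar>u\<bar> - 1)) (max (- 1) (min 1 u))"

definition loop_speed :: "real \<Rightarrow> complex" where
  "loop_speed u = (if u < - 1 then 1 else if u \<le> 1 then \<i> else - 1)"

text \<open>
  The points on the loop or outside it; the poles of the Meijer integrand lie in the complement.
\<close>
abbreviation loop_region :: "real \<Rightarrow> complex set" where
  "loop_region c \<equiv> {z. c \<le> Re z \<or> 1 \<le> \<bar>Im z\<bar>}"

definition loop_trace :: "real \<Rightarrow> complex set" where
  "loop_trace c = {z. Re z \<le> c \<and> (Re z = c \<or> \<bar>Im z\<bar> = 1)}"

lemma loop_trace_subset: "loop_trace c \<subseteq> loop_region c"
  by (auto simp: loop_trace_def)

lemma loop_point_in_region: "loop_point c u \<in> loop_region c"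
  by (auto simp: loop_point_def)

lemma norm_loop_speed [simp]: "norm (loop_speed u) = 1"
  by (simp add: loop_speed_def)

lemma has_contour_integral_linepath_affine:
  assumes "(f has_contour_integral I) (linepath z w)" "l < h"
  shows "((\<lambda>u. f (z + of_real ((u - l) / (h - l)) * (w - z)) * ((w - z) / of_real (h - l))) has_integral I) {l..h}"
proof -
  define d where "d = h - l"
  have d: "0 < d" using assms by (simp add: d_def)
  let ?g = "\<lambda>x. f (linepath z w x) * (w - z)"
  have "(?g has_integral I) (cbox 0 1)"
    using assms(1) by (simp add: has_contour_integral_linepath)
  then have "((\<lambda>x. ?g ((1 / d) *\<^sub>R x + (- l / d))) has_integral (I /\<^sub>R (1 / d) ^ DIM(real)))
      (cbox ((0 - (- l / d)) /\<^sub>R (1 / d)) ((1 - (- l / d)) /\<^sub>R (1 / d)))"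
    using d by (intro has_integral_affinity') auto
  then have "((\<lambda>x. ?g ((x - l) / d)) has_integral (of_real d * I)) {l..h}"
  proof -
    have "(0 - (- l / d)) /\<^sub>R (1 / d) = l" "(1 - (- l / d)) /\<^sub>R (1 / d) = h"
      "I /\<^sub>R (1 / d) ^ DIM(real) = of_real d * I"
      using d by (simp_all add: field_simps d_def scaleR_conv_of_real)
    moreover have "(1 / d) *\<^sub>R x + (- l / d) = (x - l) / d" for x
      by (simp add: diff_divide_distrib)
    ultimately show "((\<lambda>x. ?g ((1 / d) *\<^sub>R x + (- l / d))) has_integral (I /\<^sub>R (1 / d) ^ DIM(real)))
      (cbox ((0 - (- l / d)) /\<^sub>R (1 / d)) ((1 - (- l / d)) /\<^sub>R (1 / d))) \<Longrightarrow> ?thesis"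
      by (simp only: box_real)
  qed
  then have "((\<lambda>x. ?g ((x - l) / d) * (1 / of_real d)) has_integral (of_real d * I * (1 / of_real d))) {l..h}"
    by (rule has_integral_mult_left)
  moreover have "linepath z w t = z + of_real t * (w - z)" for t
    by (simp add: linepath_def scaleR_conv_of_real algebra_simps)
  ultimately show ?thesis using d by (simp add: d_def)
qed

lemma has_integral_loop_path:
  assumes cont: "continuous_on (loop_trace c) f" and R: "- c < R"
  shows "((\<lambda>u. f (loop_point c u) * loop_speed u) has_integral contour_integral (loop_path c R) f)
           {- (R + c + 1)..R + c + 1}"
proof -
  define T where "T = R + c + 1"
  have T: "1 < T" using R by (simp add: T_def)
  let ?g = "\<lambda>u. f (loop_point c u) * loop_speed u"
  let ?z1 = "Complex (- R) (- 1)" and ?z2 = "Complex c (- 1)" and ?z3 = "Complex c 1" and ?z4 = "Complex (- R) 1"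
  have i1: "f contour_integrable_on (linepath ?z1 ?z2)"
    by (rule contour_integrable_continuous_linepath[OF continuous_on_subset[OF cont]])
       (use R in \<open>auto simp: closed_segment_same_Im closed_segment_eq_real_ivl loop_trace_def\<close>)
  have i2: "f contour_integrable_on (linepath ?z2 ?z3)"
    by (rule contour_integrable_continuous_linepath[OF continuous_on_subset[OF cont]])
       (auto simp: closed_segment_same_Re loop_trace_def)
  have i3: "f contour_integrable_on (linepath ?z3 ?z4)"
    by (rule contour_integrable_continuous_linepath[OF continuous_on_subset[OF cont]])
       (use R in \<open>auto simp: closed_segment_same_Im closed_segment_eq_real_ivl loop_trace_def\<close>)
  have 1: "(?g has_integral contour_integral (linepath ?z1 ?z2) f) {- T..- 1}"
  proof (rule has_integral_spike_finite[of "{- 1}"])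
    show "((\<lambda>u. f (?z1 + of_real ((u - - T) / (- 1 - - T)) * (?z2 - ?z1)) * ((?z2 - ?z1) / of_real (- 1 - - T)))
       has_integral contour_integral (linepath ?z1 ?z2) f) {- T..- 1}"
      using T by (intro has_contour_integral_linepath_affine has_contour_integral_integral i1) auto
    fix u assume u: "u \<in> {- T..- 1} - {- 1}"
    have d: "?z2 - ?z1 = of_real (- 1 - - T)" by (simp add: complex_eq_iff T_def)
    have "?z1 + of_real ((u - - T) / (- 1 - - T)) * (?z2 - ?z1) = ?z1 + of_real (u + T)"
      unfolding d of_real_mult[symmetric] using T by simp
    then have "?z1 + of_real ((u - - T) / (- 1 - - T)) * (?z2 - ?z1) = loop_point c u"
      using u by (simp add: complex_eq_iff loop_point_def T_def)
    moreover have "(?z2 - ?z1) / of_real (- 1 - - T) = loop_speed u"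
      unfolding d using u T by (simp add: loop_speed_def del: of_real_diff of_real_minus)
    ultimately show "?g u = f (?z1 + of_real ((u - - T) / (- 1 - - T)) * (?z2 - ?z1)) * ((?z2 - ?z1) / of_real (- 1 - - T))"
      by simp
  qed simp
  have 2: "(?g has_integral contour_integral (linepath ?z2 ?z3) f) {- 1..1}"
  proof (rule has_integral_spike_finite[of "{}"])
    show "((\<lambda>u. f (?z2 + of_real ((u - - 1) / (1 - - 1)) * (?z3 - ?z2)) * ((?z3 - ?z2) / of_real (1 - - 1)))
       has_integral contour_integral (linepath ?z2 ?z3) f) {- 1..1}"
      by (intro has_contour_integral_linepath_affine has_contour_integral_integral i2) auto
    fix u :: real assume u: "u \<in> {- 1..1} - {}"
    have d: "?z3 - ?z2 = 2 * \<i>" by (simp add: complex_eq_iff)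
    have "?z2 + of_real ((u - - 1) / (1 - - 1)) * (?z3 - ?z2) = loop_point c u"
      unfolding d using u by (auto simp: complex_eq_iff loop_point_def max_def abs_if)
    moreover have "(?z3 - ?z2) / of_real (1 - - 1) = loop_speed u"
      unfolding d using u by (simp add: loop_speed_def)
    ultimately show "?g u = f (?z2 + of_real ((u - - 1) / (1 - - 1)) * (?z3 - ?z2)) * ((?z3 - ?z2) / of_real (1 - - 1))"
      by simp
  qed simp
  have 3: "(?g has_integral contour_integral (linepath ?z3 ?z4) f) {1..T}"
  proof (rule has_integral_spike_finite[of "{1}"])
    show "((\<lambda>u. f (?z3 + of_real ((u - 1) / (T - 1)) * (?z4 - ?z3)) * ((?z4 - ?z3) / of_real (T - 1)))
       has_integral contour_integral (linepath ?z3 ?z4) f) {1..T}"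
      using T by (intro has_contour_integral_linepath_affine has_contour_integral_integral i3) auto
    fix u assume u: "u \<in> {1..T} - {1}"
    have d: "?z4 - ?z3 = - of_real (T - 1)" by (simp add: complex_eq_iff T_def)
    have "?z3 + of_real ((u - 1) / (T - 1)) * (?z4 - ?z3) = ?z3 - of_real (u - 1)"
      unfolding d mult_minus_right of_real_mult[symmetric] using T by simp
    then have "?z3 + of_real ((u - 1) / (T - 1)) * (?z4 - ?z3) = loop_point c u"
      using u by (simp add: complex_eq_iff loop_point_def)
    moreover have "(?z4 - ?z3) / of_real (T - 1) = loop_speed u"
      unfolding d using u T by (simp add: loop_speed_def del: of_real_diff)
    ultimately show "?g u = f (?z3 + of_real ((u - 1) / (T - 1)) * (?z4 - ?z3)) * ((?z4 - ?z3) / of_real (T - 1))"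
      by simp
  qed simp
  have "contour_integral (loop_path c R) f =
      contour_integral (linepath ?z1 ?z2) f + contour_integral (linepath ?z2 ?z3) f + contour_integral (linepath ?z3 ?z4) f"
    unfolding loop_path_def using i1 i2 i3 by simp
  moreover have "(?g has_integral (contour_integral (linepath ?z1 ?z2) f + contour_integral (linepath ?z2 ?z3) f
      + contour_integral (linepath ?z3 ?z4) f)) {- T..T}"
    using T by (intro has_integral_combine[OF _ _ has_integral_combine[OF _ _ 1 2] 3]) auto
  ultimately show ?thesis by (simp add: T_def)
qed

lemma loop_integral_tendsto:
  assumes cont: "continuous_on (loop_trace c) f"
    and int: "integrable lborel (\<lambda>u. f (loop_point c u) * loop_speed u)"
  shows "((\<lambda>R. contour_integral (loop_path c R) f) \<longlongrightarrow> (\<integral>u. f (loop_point c u) * loop_speed u \<partial>lborel)) at_top"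
proof -
  let ?g = "\<lambda>u. f (loop_point c u) * loop_speed u"
  let ?s = "\<lambda>R u. indicator {- (R + c + 1)..R + c + 1} u *\<^sub>R ?g u"
  have "((\<lambda>R. integral\<^sup>L lborel (?s R)) \<longlongrightarrow> integral\<^sup>L lborel ?g) at_top"
  proof (rule integral_dominated_convergence_at_top)
    show "integrable lborel (\<lambda>u. norm (?g u))" using int by (rule integrable_norm)
    show "?g \<in> borel_measurable lborel" using int by simp
    then show "?s R \<in> borel_measurable lborel" for R by measurable
    show "AE u in lborel. ((\<lambda>R. ?s R u) \<longlongrightarrow> ?g u) at_top"
    proof (rule AE_I2)
      fix u :: real
      have "eventually (\<lambda>R. ?s R u = ?g u) at_top"
        using eventually_ge_at_top[of "\<bar>u\<bar> - c - 1"] by eventually_elim (auto split: split_indicator)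
      then show "((\<lambda>R. ?s R u) \<longlongrightarrow> ?g u) at_top"
        by (rule tendsto_eventually)
    qed
    show "\<forall>\<^sub>F R in at_top. AE u in lborel. norm (?s R u) \<le> norm (?g u)"
      by (auto split: split_indicator)
  qed
  moreover have "eventually (\<lambda>R. integral\<^sup>L lborel (?s R) = contour_integral (loop_path c R) f) at_top"
    using eventually_gt_at_top[of "- c"]
  proof eventually_elim
    case (elim R)
    have "set_integrable lborel {- (R + c + 1)..R + c + 1} ?g"
      unfolding set_integrable_def by (rule integrable_mult_indicator[OF _ int]) simp
    from set_borel_integral_eq_integral(2)[OF this]
    show ?case
      using integral_unique[OF has_integral_loop_path[OF cont elim]]
      unfolding set_lebesgue_integral_def by simp
  qed
  ultimately show ?thesis by (rule Lim_transform_eventually)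
qed

lemma convex_linepath_primitive:
  assumes "convex S" "open S" "f holomorphic_on S"
  obtains F where "\<forall>x\<in>S. \<forall>y\<in>S. (f has_contour_integral (F y - F x)) (linepath x y)"
proof -
  obtain F where F: "\<And>x. x \<in> S \<Longrightarrow> (F has_field_derivative f x) (at x within S)"
    using holomorphic_convex_primitive'[OF assms] by blast
  have "(f has_contour_integral (F y - F x)) (linepath x y)" if "x \<in> S" "y \<in> S" for x y
    using contour_integral_primitive[OF F valid_path_linepath, of x y]
      closed_segment_subset[OF that \<open>convex S\<close>] by simp
  then show ?thesis using that by blast
qed

text \<open>
  The poles lie to the left of \<open>-\<alpha>\<close>, so none of them is between the two vertical edges. This allows
  the edge to be moved to a negative abscissa, as needed to reach the moment of order \<open>0\<close>.
\<close>
lemma contour_integral_loop_path_shift: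
  assumes hol: "f holomorphic_on {z. Im z \<noteq> 0 \<or> - \<alpha> < Re z}" and c: "- \<alpha> < c" "- \<alpha> < d"
  shows "contour_integral (loop_path c R) f = contour_integral (loop_path d R) f"
proof -
  obtain F where F: "\<forall>x\<in>{z. Im z < 0}. \<forall>y\<in>{z. Im z < 0}. (f has_contour_integral (F y - F x)) (linepath x y)"
  proof (rule convex_linepath_primitive)
    show "convex {z. Im z < 0}" by (rule convex_halfspace_Im_lt)
    show "open {z. Im z < 0}" by (rule open_halfspace_Im_lt)
    show "f holomorphic_on {z. Im z < 0}" by (rule holomorphic_on_subset[OF hol]) auto
  qed
  obtain G where G: "\<forall>x\<in>{z. 0 < Im z}. \<forall>y\<in>{z. 0 < Im z}. (f has_contour_integral (G y - G x)) (linepath x y)"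
  proof (rule convex_linepath_primitive)
    show "convex {z. 0 < Im z}" by (rule convex_halfspace_Im_gt)
    show "open {z. 0 < Im z}" by (rule open_halfspace_Im_gt)
    show "f holomorphic_on {z. 0 < Im z}" by (rule holomorphic_on_subset[OF hol]) auto
  qed
  obtain H where H: "\<forall>x\<in>{z. - \<alpha> < Re z}. \<forall>y\<in>{z. - \<alpha> < Re z}. (f has_contour_integral (H y - H x)) (linepath x y)"
  proof (rule convex_linepath_primitive)
    show "convex {z. - \<alpha> < Re z}" by (rule convex_halfspace_Re_gt)
    show "open {z. - \<alpha> < Re z}" by (rule open_halfspace_Re_gt)
    show "f holomorphic_on {z. - \<alpha> < Re z}" by (rule holomorphic_on_subset[OF hol]) auto
  qed
  have loop: "contour_integral (loop_path e R) f = (F (Complex e (-1)) - F (Complex (- R) (-1)))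
      + (H (Complex e 1) - H (Complex e (-1))) + (G (Complex (- R) 1) - G (Complex e 1))" if "- \<alpha> < e" for e
  proof -
    have "(f has_contour_integral ((F (Complex e (-1)) - F (Complex (- R) (-1)))
      + ((H (Complex e 1) - H (Complex e (-1))) + (G (Complex (- R) 1) - G (Complex e 1))))) (loop_path e R)"
      unfolding loop_path_def using that by (intro has_contour_integral_join F[rule_format] G[rule_format] H[rule_format]) auto
    then show ?thesis by (simp add: contour_integral_unique)
  qed
  have "F (Complex c (-1)) - F (Complex d (-1)) = H (Complex c (-1)) - H (Complex d (-1))"
    using F[rule_format, of "Complex d (-1)" "Complex c (-1)"] H[rule_format, of "Complex d (-1)" "Complex c (-1)"] c
    by (simp add: has_contour_integral_unique)
  moreover have "G (Complex c 1) - G (Complex d 1) = H (Complex c 1) - H (Complex d 1)"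
    using G[rule_format, of "Complex d 1" "Complex c 1"] H[rule_format, of "Complex d 1" "Complex c 1"] c
    by (simp add: has_contour_integral_unique)
  ultimately show ?thesis
    unfolding loop[OF c(1)] loop[OF c(2)] by (simp add: algebra_simps)
qed

lemma diff_kernel_decay:
  fixes p :: real
  assumes p: "0 \<le> p"
  obtains D where "D > 0"
    "\<forall>z :: complex. 2 * (p + real (N * m)) \<le> norm z \<and> 0 < norm z \<longrightarrow>
       norm (diff_kernel N m (of_real p - z)) \<le> D / norm z ^ Suc N"
proof
  let ?D = "real m ^ N * fact N * 2 ^ Suc N + 1"
  show "0 < ?D" by (simp add: add_nonneg_pos)
  show "\<forall>z :: complex. 2 * (p + real (N * m)) \<le> norm z \<and> 0 < norm z \<longrightarrow>
       norm (diff_kernel N m (of_real p - z)) \<le> ?D / norm z ^ Suc N"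
  proof (intro allI impI, elim conjE)
    fix z :: complex assume z: "2 * (p + real (N * m)) \<le> norm z" "0 < norm z"
    have lower: "norm z / 2 \<le> norm (of_real p - z + of_nat (k * m))" if "k \<le> N" for k
    proof -
      have "real (k * m) \<le> real (N * m)" using that by (intro of_nat_mono mult_right_mono) auto
      then have "norm (complex_of_real (p + real (k * m))) \<le> norm z / 2"
        using z p by (subst norm_of_real) simp
      moreover have "norm z - norm (complex_of_real (p + real (k * m))) \<le> norm (z - complex_of_real (p + real (k * m)))"
        by (rule norm_triangle_ineq2)
      moreover have "norm (z - complex_of_real (p + real (k * m))) = norm (of_real p - z + of_nat (k * m))"
        by (subst norm_minus_commute) (simp add: algebra_simps)
      ultimately show ?thesis by linarith
    qed
    have nz: "of_real p - z + of_nat (k * m) \<noteq> 0" if "k \<le> N" for k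
      using lower[OF that] z by auto
    have "norm (diff_kernel N m (of_real p - z))
        = real m ^ N * fact N / (\<Prod>k\<le>N. norm (of_real p - z + of_nat (k * m)))"
      by (subst diff_kernel_eq[OF nz]) (simp_all add: norm_mult norm_divide norm_power prod_norm[symmetric] norm_fact del: of_nat_mult)
    also have "\<dots> \<le> real m ^ N * fact N / (\<Prod>k\<le>N. norm z / 2)"
    proof (rule divide_left_mono)
      show "(\<Prod>k\<le>N. norm z / 2) \<le> (\<Prod>k\<le>N. norm (of_real p - z + of_nat (k * m)))"
        using z by (intro prod_mono conjI lower) auto
      show "0 < (\<Prod>k\<le>N. norm (of_real p - z + of_nat (k * m))) * (\<Prod>k\<le>N. norm z / 2)"
        using z nz by (intro mult_pos_pos prod_pos) (auto simp del: of_nat_mult)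
    qed simp
    also have "\<dots> = real m ^ N * fact N * 2 ^ Suc N / norm z ^ Suc N"
      by (simp add: power_divide)
    also have "\<dots> \<le> ?D / norm z ^ Suc N"
      using z by (intro divide_right_mono) auto
    finally show "norm (diff_kernel N m (of_real p - z)) \<le> ?D / norm z ^ Suc N" .
  qed
qed

text \<open>
  The segments that close the truncated loop avoid the strip around the poles and recede from the
  origin at the rate \<open>R\<close>. The sign \<open>e\<close> selects the upper or the lower one.
\<close>
lemma slanted_segment:
  assumes z: "z \<in> closed_segment (Complex (- R) e) (Complex c (e * R))" and e: "\<bar>e\<bar> = 1"
    and R: "1 \<le> R" "2 * \<bar>c\<bar> \<le> R"
  shows "1 \<le> e * Im z" "R / 4 \<le> norm z"
proof -
  obtain t where t: "0 \<le> t" "t \<le> 1" "z = (1 - t) *\<^sub>R Complex (- R) e + t *\<^sub>R Complex c (e * R)"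
    using z by (auto simp: closed_segment_def)
  have ee: "e * e = 1" using e by (metis abs_mult_self_eq mult_1)
  have "e * Im z = (1 - t) * (e * e) + t * (e * e) * R" by (subst t(3)) (simp add: algebra_simps)
  then have im: "e * Im z = (1 - t) + t * R" by (simp add: ee)
  have "t * 1 \<le> t * R" using t R by (intro mult_left_mono) auto
  then show 1: "1 \<le> e * Im z" using im by simp
  have "e * Im z = \<bar>Im z\<bar>" using e 1 by (metis abs_mult abs_of_nonneg mult_1 order_trans zero_le_one)
  also have "\<dots> \<le> norm z" by (rule abs_Im_le_cmod)
  finally have a: "(1 - t) + t * R \<le> norm z" using im by simp
  have "Re z = - ((1 - t) * R) + t * c" using t by simp
  then have b: "(1 - t) * R - t * c \<le> norm z" using abs_Re_le_cmod[of z] by linarith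
  have "t * c \<le> t * \<bar>c\<bar>" using t by (intro mult_left_mono) auto
  moreover have "t * \<bar>c\<bar> \<le> 1 * \<bar>c\<bar>" using t by (intro mult_right_mono) auto
  moreover have "(1 - t) * R + t * R = R" by (simp add: algebra_simps)
  ultimately have "R - \<bar>c\<bar> \<le> 2 * norm z" using a b t by linarith
  then show "R / 4 \<le> norm z" using R by linarith
qed

text \<open>
  Join the ends of the truncated loop to the points \<open>c \<plusminus> i R\<close> of the vertical line and close that
  line by a rectangle on the right. The added segments have total length of order \<open>R\<close> and the
  integrand is of order \<open>R\<^bsup>-2\<^esup>\<close> on them, so in the limit only the simple poles of the kernel
  contribute. They are encircled clockwise, which cancels the sign in \<open>p - z = - (z - p)\<close>.
\<close>
lemma loop_integral_by_residues:
  fixes f :: "complex \<Rightarrow> complex" and \<alpha> c p C K :: real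
  assumes hol: "f holomorphic_on {z. Im z \<noteq> 0 \<or> - \<alpha> < Re z}" and c: "- \<alpha> < c" "c < p"
    and decay: "\<And>z. z \<in> loop_region c \<Longrightarrow> K \<le> norm z \<Longrightarrow>
       norm (f z * diff_kernel N m (of_real p - z)) \<le> C / norm z ^ 2" and C: "0 \<le> C"
  shows "((\<lambda>R. contour_integral (loop_path c R) (\<lambda>z. f z * diff_kernel N m (of_real p - z))) \<longlongrightarrow>
     2 * pi * \<i> * (\<Sum>k\<le>N. (-1) ^ k * of_nat (N choose k) * f (of_real (p + real (k * m))))) at_top"
proof -
  define P where "P = (\<lambda>k. complex_of_real (p + real (k * m)))"
  define g where "g = (\<lambda>z. f z * diff_kernel N m (of_real p - z))"
  define S where "S = (\<Sum>k\<le>N. (-1) ^ k * of_nat (N choose k) * f (P k))"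
  have PIm: "Im (P k) = 0" and PRe: "c < Re (P k)" for k
  proof -
    have "0 \<le> real (k * m)" by (rule of_nat_0_le_iff)
    then show "c < Re (P k)" using c(2) unfolding P_def Re_complex_of_real by linarith
  qed (simp add: P_def)
  define A where "A = {z. (Im z \<noteq> 0 \<or> - \<alpha> < Re z) \<and> (\<forall>k\<le>N. z \<noteq> P k)}"
  have g_eq: "g z = (\<Sum>k\<le>N. (- ((-1) ^ k * of_nat (N choose k))) * (f z / (z - P k)))" for z
  proof -
    have d: "of_real p - z + of_nat (k * m) = - (z - P k)" for k by (simp add: P_def)
    show ?thesis unfolding g_def diff_kernel_def d sum_distrib_left divide_minus_right
      by (intro sum.cong refl) simp
  qed
  have holg: "g holomorphic_on A"
    unfolding g_eq using holomorphic_on_subset[OF hol, of A]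
    by (intro holomorphic_intros) (auto simp: A_def)
  have contg: "continuous_on T g" if "T \<subseteq> A" for T
    using holomorphic_on_imp_continuous_on[OF holg] continuous_on_subset that by blast
  have offA: "z \<in> A" if "Im z \<noteq> 0" for z using that PIm by (auto simp: A_def)
  obtain F where F: "\<forall>x\<in>{z. Im z < 0}. \<forall>y\<in>{z. Im z < 0}. (g has_contour_integral (F y - F x)) (linepath x y)"
  proof (rule convex_linepath_primitive)
    show "convex {z. Im z < 0}" by (rule convex_halfspace_Im_lt)
    show "open {z. Im z < 0}" by (rule open_halfspace_Im_lt)
    show "g holomorphic_on {z. Im z < 0}" by (rule holomorphic_on_subset[OF holg]) (auto intro: offA)
  qed
  obtain G where G: "\<forall>x\<in>{z. 0 < Im z}. \<forall>y\<in>{z. 0 < Im z}. (g has_contour_integral (G y - G x)) (linepath x y)"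
  proof (rule convex_linepath_primitive)
    show "convex {z. 0 < Im z}" by (rule convex_halfspace_Im_gt)
    show "open {z. 0 < Im z}" by (rule open_halfspace_Im_gt)
    show "g holomorphic_on {z. 0 < Im z}" by (rule holomorphic_on_subset[OF holg]) (auto intro: offA)
  qed
  \<comment> \<open>A radius beyond which all poles of the kernel are enclosed and the decay bound holds at distance \<open>R / 4\<close>.\<close>
  define B where "B = 1 + 2 * \<bar>c\<bar> + 4 * \<bar>K\<bar> + \<bar>p\<bar> + real (N * m)"
  \<comment> \<open>Five segments, each of length at most \<open>4 R\<close> and at distance at least \<open>R / 4\<close> from the origin.\<close>
  have est: "norm (contour_integral (loop_path c R) g - 2 * pi * \<i> * S) \<le> 320 * C / R" if R: "B \<le> R" for R
  proof -
    have R': "1 \<le> R" "2 * \<bar>c\<bar> \<le> R" "4 * \<bar>K\<bar> \<le> R" "0 < R"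
      using R of_nat_0_le_iff[of "N * m"] unfolding B_def by linarith+
    have Rp: "Re (P k) < R" if "k \<le> N" for k
    proof -
      have "real (k * m) \<le> real (N * m)" using that by (intro of_nat_mono mult_right_mono) auto
      then show ?thesis using R unfolding B_def P_def Re_complex_of_real by linarith
    qed
    let ?z1 = "Complex (- R) (- 1)" and ?z2 = "Complex c (- 1)" and ?z3 = "Complex c 1" and ?z4 = "Complex (- R) 1"
    let ?w2 = "Complex c (- R)" and ?w3 = "Complex c R" and ?v2 = "Complex R (- R)" and ?v3 = "Complex R R"
    have segA: "closed_segment (Complex c y) (Complex c y') \<subseteq> A" for y y'
    proof
      fix z assume "z \<in> closed_segment (Complex c y) (Complex c y')"
      then have "Re z = c" by (simp add: closed_segment_same_Re)
      then show "z \<in> A" using c PRe by (auto simp: A_def)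
    qed
    have intc: "g contour_integrable_on linepath (Complex c y) (Complex c y')" for y y'
      by (intro contour_integrable_continuous_linepath contg segA)
    have V: "contour_integral (linepath ?w2 ?w3) g =
        (F ?z2 - F ?w2) + contour_integral (linepath ?z2 ?z3) g + (G ?w3 - G ?z3)"
    proof -
      have "contour_integral (linepath ?w2 ?w3) g = contour_integral (linepath ?w2 ?z2) g + contour_integral (linepath ?z2 ?w3) g"
        using R' by (intro contour_integral_split_linepath contg segA) (auto simp: closed_segment_same_Re closed_segment_eq_real_ivl)
      also have "contour_integral (linepath ?z2 ?w3) g = contour_integral (linepath ?z2 ?z3) g + contour_integral (linepath ?z3 ?w3) g"
        using R' by (intro contour_integral_split_linepath contg segA) (auto simp: closed_segment_same_Re closed_segment_eq_real_ivl)
      also have "contour_integral (linepath ?w2 ?z2) g = F ?z2 - F ?w2"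
        using R' by (intro contour_integral_unique F[rule_format]) auto
      also have "contour_integral (linepath ?z3 ?w3) g = G ?w3 - G ?z3"
        using R' by (intro contour_integral_unique G[rule_format]) auto
      finally show ?thesis by simp
    qed
    have "(g has_contour_integral ((F ?z2 - F ?z1) + (contour_integral (linepath ?z2 ?z3) g + (G ?z4 - G ?z3)))) (loop_path c R)"
      unfolding loop_path_def using R'
      by (intro has_contour_integral_join has_contour_integral_integral intc F[rule_format] G[rule_format]) auto
    then have L: "contour_integral (loop_path c R) g =
        contour_integral (linepath ?w2 ?w3) g + (F ?w2 - F ?z1) + (G ?z4 - G ?w3)"
      using V by (simp add: contour_integral_unique)
    have rect_image: "path_image (rectpath ?w2 ?v3) \<subseteq> {z. - \<alpha> < Re z} - {P k}" if "k \<le> N" for k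
    proof -
      have "path_image (rectpath ?w2 ?v3) = cbox ?w2 ?v3 - box ?w2 ?v3"
        using R' by (intro path_image_rectpath_cbox_minus_box) auto
      moreover have "P k \<in> box ?w2 ?v3"
        using Rp[OF that] R' PRe[of k] by (simp add: in_box_complex_iff PIm)
      moreover have "cbox ?w2 ?v3 \<subseteq> {z. - \<alpha> < Re z}"
      proof
        fix z assume "z \<in> cbox ?w2 ?v3"
        then have "c \<le> Re z" by (simp add: in_cbox_complex_iff)
        then show "z \<in> {z. - \<alpha> < Re z}" using c by simp
      qed
      ultimately show ?thesis by blast
    qed
    have "((\<lambda>z. f z / (z - P k)) has_contour_integral (2 * pi * \<i> * f (P k))) (rectpath ?w2 ?v3)" if k: "k \<le> N" for k
    proof -
      have "((\<lambda>z. f z / (z - P k)) has_contour_integral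
          (2 * pi * \<i> * winding_number (rectpath ?w2 ?v3) (P k) * f (P k))) (rectpath ?w2 ?v3)"
      proof (rule Cauchy_integral_formula_convex_simple)
        show "convex {z. - \<alpha> < Re z}" by (rule convex_halfspace_Re_gt)
        show "f holomorphic_on {z. - \<alpha> < Re z}" by (rule holomorphic_on_subset[OF hol]) auto
        show "P k \<in> interior {z. - \<alpha> < Re z}"
          using c PRe[of k] by (simp add: interior_open open_halfspace_Re_gt)
      qed (use rect_image[OF k] in auto)
      moreover have "winding_number (rectpath ?w2 ?v3) (P k) = 1"
        using Rp[OF k] R' PRe[of k] by (intro winding_number_rectpath) (simp add: in_box_complex_iff PIm)
      ultimately show ?thesis by simp
    qed
    then have "(g has_contour_integral (\<Sum>k\<le>N. (- ((-1) ^ k * of_nat (N choose k))) * (2 * pi * \<i> * f (P k)))) (rectpath ?w2 ?v3)"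
      unfolding g_eq by (intro has_contour_integral_sum has_contour_integral_lmul) auto
    also have "(\<Sum>k\<le>N. (- ((-1) ^ k * of_nat (N choose k))) * (2 * pi * \<i> * f (P k))) = - (2 * pi * \<i> * S)"
      unfolding S_def sum_distrib_left sum_negf[symmetric] by (intro sum.cong refl) simp
    finally have rect: "contour_integral (rectpath ?w2 ?v3) g = - (2 * pi * \<i> * S)"
      by (rule contour_integral_unique)
    have int1: "g contour_integrable_on linepath ?w2 ?v2"
      using R' by (intro contour_integrable_continuous_linepath contg) (auto simp: closed_segment_same_Im intro!: offA)
    have int3: "g contour_integrable_on linepath ?v3 ?w3"
      using R' by (intro contour_integrable_continuous_linepath contg) (auto simp: closed_segment_same_Im intro!: offA)
    have int2: "g contour_integrable_on linepath ?v2 ?v3"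
    proof (intro contour_integrable_continuous_linepath contg)
      show "closed_segment ?v2 ?v3 \<subseteq> A"
      proof
        fix z assume "z \<in> closed_segment ?v2 ?v3"
        then have "Re z = R" by (simp add: closed_segment_same_Re)
        then show "z \<in> A" using c R' Rp by (force simp: A_def)
      qed
    qed
    have rev_edge: "contour_integral (linepath ?w3 ?w2) g = - contour_integral (linepath ?w2 ?w3) g"
      using contour_integral_reversepath[of "linepath ?w2 ?w3" g] by simp
    have "contour_integral (rectpath ?w2 ?v3) g = contour_integral (linepath ?w2 ?v2) g
       + (contour_integral (linepath ?v2 ?v3) g + (contour_integral (linepath ?v3 ?w3) g + contour_integral (linepath ?w3 ?w2) g))"
      unfolding rectpath_def Let_def using int1 int2 int3 intc by simp
    then have W: "contour_integral (linepath ?w2 ?w3) g = 2 * pi * \<i> * S + (contour_integral (linepath ?w2 ?v2) g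
       + contour_integral (linepath ?v2 ?v3) g + contour_integral (linepath ?v3 ?w3) g)"
      unfolding rect rev_edge by (simp add: algebra_simps)
    have I4: "contour_integral (linepath ?z1 ?w2) g = F ?w2 - F ?z1"
      using R' by (intro contour_integral_unique F[rule_format]) auto
    have I5: "contour_integral (linepath ?w3 ?z4) g = G ?z4 - G ?w3"
      using R' by (intro contour_integral_unique G[rule_format]) auto
    have eq: "contour_integral (loop_path c R) g - 2 * pi * \<i> * S =
       contour_integral (linepath ?w2 ?v2) g + contour_integral (linepath ?v2 ?v3) g + contour_integral (linepath ?v3 ?w3) g
       + contour_integral (linepath ?z1 ?w2) g + contour_integral (linepath ?w3 ?z4) g"
      unfolding L W I4 I5 by simp
    have seg: "norm (contour_integral (linepath x y) g) \<le> 64 * C / R"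
      if int: "g contour_integrable_on linepath x y" and len: "norm (y - x) \<le> 4 * R"
        and far: "\<And>z. z \<in> closed_segment x y \<Longrightarrow> z \<in> loop_region c \<and> R / 4 \<le> norm z" for x y
    proof -
      have "norm (contour_integral (linepath x y) g) \<le> (16 * C / R ^ 2) * norm (y - x)"
      proof (rule contour_integral_bound_linepath[OF int])
        fix z assume z: "z \<in> closed_segment x y"
        have "norm (g z) \<le> C / norm z ^ 2"
          unfolding g_def using far[OF z] R' by (intro decay) auto
        also have "\<dots> \<le> C / (R / 4) ^ 2"
          using far[OF z] R' C by (intro divide_left_mono power_mono mult_pos_pos zero_less_power) auto
        also have "\<dots> = 16 * C / R ^ 2" by (simp add: power_divide)
        finally show "norm (g z) \<le> 16 * C / R ^ 2" .
      qed (use C R' in auto)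
      also have "\<dots> \<le> (16 * C / R ^ 2) * (4 * R)"
        using C R' len by (intro mult_left_mono) auto
      also have "\<dots> = 64 * C / R" using R' by (simp add: power2_eq_square)
      finally show ?thesis .
    qed
    have len: "norm (Complex x y - Complex x' y') \<le> \<bar>x - x'\<bar> + \<bar>y - y'\<bar>" for x y x' y'
      using cmod_le[of "Complex x y - Complex x' y'"] by simp
    have s1: "norm (contour_integral (linepath ?w2 ?v2) g) \<le> 64 * C / R"
    proof (rule seg[OF int1])
      show "norm (?v2 - ?w2) \<le> 4 * R" using len[of R "- R" c "- R"] R' by linarith
      fix z assume "z \<in> closed_segment ?w2 ?v2"
      then show "z \<in> loop_region c \<and> R / 4 \<le> norm z"
        using R' abs_Im_le_cmod[of z] by (auto simp: closed_segment_same_Im)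
    qed
    have s3: "norm (contour_integral (linepath ?v3 ?w3) g) \<le> 64 * C / R"
    proof (rule seg[OF int3])
      show "norm (?w3 - ?v3) \<le> 4 * R" using len[of c R R R] R' by linarith
      fix z assume "z \<in> closed_segment ?v3 ?w3"
      then show "z \<in> loop_region c \<and> R / 4 \<le> norm z"
        using R' abs_Im_le_cmod[of z] by (auto simp: closed_segment_same_Im)
    qed
    have s2: "norm (contour_integral (linepath ?v2 ?v3) g) \<le> 64 * C / R"
    proof (rule seg[OF int2])
      show "norm (?v3 - ?v2) \<le> 4 * R" using len[of R R R "- R"] R' by linarith
      fix z assume "z \<in> closed_segment ?v2 ?v3"
      then show "z \<in> loop_region c \<and> R / 4 \<le> norm z"
        using R' abs_Re_le_cmod[of z] by (auto simp: closed_segment_same_Re)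
    qed
    have s4: "norm (contour_integral (linepath ?z1 ?w2) g) \<le> 64 * C / R"
    proof (rule seg)
      show "g contour_integrable_on linepath ?z1 ?w2"
        using F[rule_format, of ?z1 ?w2] R' by (auto simp: contour_integrable_on_def)
      show "norm (?w2 - ?z1) \<le> 4 * R" using len[of c "- R" "- R" "- 1"] R' by linarith
      fix z assume "z \<in> closed_segment ?z1 ?w2"
      then show "z \<in> loop_region c \<and> R / 4 \<le> norm z"
        using R' slanted_segment[of z R "- 1" c] by auto
    qed
    have s5: "norm (contour_integral (linepath ?w3 ?z4) g) \<le> 64 * C / R"
    proof (rule seg)
      show "g contour_integrable_on linepath ?w3 ?z4"
        using G[rule_format, of ?w3 ?z4] R' by (auto simp: contour_integrable_on_def)
      show "norm (?z4 - ?w3) \<le> 4 * R" using len[of "- R" 1 c R] R' by linarith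
      fix z assume "z \<in> closed_segment ?w3 ?z4"
      then show "z \<in> loop_region c \<and> R / 4 \<le> norm z"
        using R' slanted_segment[of z R 1 c] by (auto simp: closed_segment_commute[of ?w3])
    qed
    show ?thesis
    proof -
      have tri: "norm (v1 + v2 + v3 + v4 + v5) \<le> norm v1 + norm v2 + norm v3 + norm v4 + norm v5"
        for v1 v2 v3 v4 v5 :: complex
        by (intro norm_triangle_le add_right_mono norm_triangle_ineq)
      show ?thesis
        unfolding eq by (rule order.trans[OF tri]) (use s1 s2 s3 s4 s5 in linarith)
    qed
  qed
  have "((\<lambda>R. contour_integral (loop_path c R) g - 2 * pi * \<i> * S) \<longlongrightarrow> 0) at_top"
  proof (rule Lim_null_comparison)
    show "eventually (\<lambda>R. norm (contour_integral (loop_path c R) g - 2 * pi * \<i> * S) \<le> 320 * C / R) at_top"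
      using eventually_ge_at_top[of B] by eventually_elim (rule est)
    show "((\<lambda>R. 320 * C / R) \<longlongrightarrow> 0) at_top"
      by (rule tendsto_divide_0[OF tendsto_const]) (simp add: filterlim_ident filterlim_at_top_imp_at_infinity)
  qed
  then show ?thesis
    by (simp add: Lim_null[symmetric] g_def S_def P_def flip: Lim_null)
qed

section \<open>Moments of the Meijer G-function\<close>

lemma integrable_inverse_square_dominated:
  fixes f :: "real \<Rightarrow> complex"
  assumes [measurable]: "f \<in> borel_measurable lborel"
    and bound: "\<And>u. norm (f u) \<le> B / (1 + \<bar>u\<bar>) ^ 2"
  shows "integrable lborel f"
proof (rule Bochner_Integration.integrable_bound)
  show "integrable lborel (\<lambda>u. \<bar>B\<bar> * inverse (1 + u ^ 2))"
    using integrable_inverse_1_plus_square by (intro integrable_mult_right) (simp add: set_integrable_def)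
  show "AE u in lborel. norm (f u) \<le> norm (\<bar>B\<bar> * inverse (1 + u ^ 2))"
  proof (rule AE_I2)
    fix u :: real
    have pos: "0 < 1 + u ^ 2" by (simp add: add_pos_nonneg)
    have "1 + u ^ 2 \<le> (1 + \<bar>u\<bar>) ^ 2" by (simp add: power2_eq_square algebra_simps)
    then have "\<bar>B\<bar> / (1 + \<bar>u\<bar>) ^ 2 \<le> \<bar>B\<bar> / (1 + u ^ 2)"
      using pos by (intro divide_left_mono mult_pos_pos) auto
    moreover have "B / (1 + \<bar>u\<bar>) ^ 2 \<le> \<bar>B\<bar> / (1 + \<bar>u\<bar>) ^ 2"
      by (intro divide_right_mono) auto
    ultimately have "norm (f u) \<le> \<bar>B\<bar> / (1 + u ^ 2)" using bound[of u] by linarith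
    then show "norm (f u) \<le> norm (\<bar>B\<bar> * inverse (1 + u ^ 2))"
      using pos by (simp add: divide_inverse abs_mult)
  qed
qed simp

lemma power_le_exp:
  fixes x :: real
  assumes "0 \<le> x" "0 < n"
  shows "x ^ n \<le> real n ^ n * exp x"
proof -
  have "(x / real n) ^ n \<le> (1 + x / real n) ^ n"
    using assms by (intro power_mono) auto
  also have "\<dots> \<le> exp x" using assms by (intro exp_ge_one_plus_x_over_n_power_n) auto
  finally show ?thesis using assms by (simp add: power_divide field_simps)
qed

lemma loop_point_Re: "Re (loop_point c u) = c - max 0 (\<bar>u\<bar> - 1)"
  by (simp add: loop_point_def)

lemma norm_loop_point: "1 + norm (loop_point c u) \<le> (2 + \<bar>c\<bar>) * (1 + \<bar>u\<bar>)"
proof -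
  have "norm (loop_point c u) \<le> \<bar>c - max 0 (\<bar>u\<bar> - 1)\<bar> + \<bar>max (- 1) (min 1 u)\<bar>"
    using cmod_le[of "loop_point c u"] by (simp add: loop_point_def)
  also have "\<bar>max (- 1) (min 1 u)\<bar> \<le> 1" by linarith
  also have "\<bar>c - max 0 (\<bar>u\<bar> - 1)\<bar> \<le> \<bar>c\<bar> + \<bar>u\<bar>" by linarith
  finally have "1 + norm (loop_point c u) \<le> 2 + \<bar>c\<bar> + \<bar>u\<bar>" by simp
  also have "\<dots> \<le> (2 + \<bar>c\<bar>) * (1 + \<bar>u\<bar>)" by (simp add: algebra_simps)
  finally show ?thesis .
qed

lemma continuous_loop_point: "continuous_on UNIV (loop_point c)"
  unfolding loop_point_def Complex_eq by (intro continuous_intros)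

lemma measurable_loop_speed [measurable]: "loop_speed \<in> borel_measurable borel"
  unfolding loop_speed_def[abs_def] by measurable

lemma measurable_loop_point [measurable]: "loop_point c \<in> borel_measurable borel"
  by (rule borel_measurable_continuous_onI[OF continuous_loop_point])

text \<open>
  The points \<open>w + k m\<close> lie at least as far to the right as \<open>w\<close>.
\<close>
lemma norm_diff_kernel_le:
  fixes w :: complex
  assumes "0 < Re w"
  shows "norm (diff_kernel N m w) \<le> real m ^ N * fact N / Re w ^ Suc N"
proof -
  have le: "Re w \<le> norm (w + of_nat (k * m))" for k
  proof -
    have "Re w \<le> Re (w + of_nat (k * m))" by simp
    also have "\<dots> \<le> norm (w + of_nat (k * m))" by (rule complex_Re_le_cmod)
    finally show ?thesis .
  qed
  have nz: "w + of_nat (k * m) \<noteq> 0" for k using le[of k] assms by auto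
  have "norm (diff_kernel N m w) = real m ^ N * fact N / (\<Prod>k\<le>N. norm (w + of_nat (k * m)))"
    by (subst diff_kernel_eq[OF nz])
      (simp_all add: norm_mult norm_divide norm_power prod_norm[symmetric] norm_fact del: of_nat_mult)
  also have "\<dots> \<le> real m ^ N * fact N / (\<Prod>k\<le>N. Re w)"
  proof (rule divide_left_mono)
    show "(\<Prod>k\<le>N. Re w) \<le> (\<Prod>k\<le>N. norm (w + of_nat (k * m)))"
      using assms by (intro prod_mono conjI le) auto
    show "0 < (\<Prod>k\<le>N. norm (w + of_nat (k * m))) * (\<Prod>k\<le>N. Re w)"
      using assms nz by (intro mult_pos_pos prod_pos) (auto simp del: of_nat_mult)
  qed simp
  finally show ?thesis by simp
qed

text \<open>
  The number \<open>c\<close> is the abscissa of the vertical edge of the loop. It lies to the right of all poles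
  and is negative, so that \<open>p - z\<close> has positive real part for \<open>z\<close> on the loop and all \<open>p \<ge> 0\<close>.
\<close>
locale meijer_parameters =
  fixes q :: nat and a b :: "nat \<Rightarrow> real" and c :: real
  assumes q: "1 \<le> q"
    and a_pos: "\<And>i. i \<in> {1..q} \<Longrightarrow> 0 < a i"
    and b_pos: "\<And>i. i \<in> {1..q} \<Longrightarrow> 0 < b i"
    and sum_le: "(\<Sum>i=1..q. a i) \<le> (\<Sum>i=1..q. b i)"
    and c_neg: "c < 0"
    and c_gt: "\<And>i. i \<in> {1..q} \<Longrightarrow> 0 < a i + c"
begin

abbreviation \<Phi> :: "complex \<Rightarrow> complex" where "\<Phi> \<equiv> gamma_ratio q a b"

definition \<alpha> :: real where "\<alpha> = Min (a ` {1..q})"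

lemma \<alpha>_le: "i \<in> {1..q} \<Longrightarrow> \<alpha> \<le> a i"
  by (simp add: \<alpha>_def)

lemma c_gt_\<alpha>: "- \<alpha> < c"
proof -
  have "\<alpha> \<in> a ` {1..q}" unfolding \<alpha>_def using q by (intro Min_in) auto
  then obtain i where "i \<in> {1..q}" "\<alpha> = a i" by blast
  then show ?thesis using c_gt[of i] by simp
qed

lemma holomorphic_\<Phi>: "\<Phi> holomorphic_on {z. Im z \<noteq> 0 \<or> - \<alpha> < Re z}"
  by (rule gamma_ratio_holomorphic) (rule \<alpha>_le)

lemma region_subset: "loop_region c \<subseteq> {z. Im z \<noteq> 0 \<or> - \<alpha> < Re z}"
  using c_gt_\<alpha> by auto

lemma continuous_\<Phi>: "continuous_on (loop_region c) \<Phi>"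
  by (rule continuous_on_subset[OF holomorphic_on_imp_continuous_on[OF holomorphic_\<Phi>] region_subset])

lemma measurable_\<Phi>_loop [measurable]: "(\<lambda>u. \<Phi> (loop_point c u)) \<in> borel_measurable borel"
proof (rule borel_measurable_continuous_onI)
  have "loop_point c ` UNIV \<subseteq> loop_region c"
    by (rule image_subsetI) (rule loop_point_in_region)
  then show "continuous_on UNIV (\<lambda>u. \<Phi> (loop_point c u))"
    by (rule continuous_on_compose2[OF continuous_\<Phi> continuous_loop_point])
qed

lemma \<Phi>_bound:
  obtains C M where "C > 0" "\<forall>z\<in>loop_region c. norm (\<Phi> z) \<le> C * (1 + norm z) ^ M"
proof -
  have "poly_bounded_on (loop_region c) \<Phi>"
    by (rule gamma_ratio_poly_bounded) (rule c_gt)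
  from this that show ?thesis by (rule poly_bounded_onE)
qed

lemma \<Phi>_loop_bound:
  assumes "\<And>z. z \<in> loop_region c \<Longrightarrow> norm (\<Phi> z) \<le> C * (1 + norm z) ^ M" "0 < C"
  shows "norm (\<Phi> (loop_point c u)) \<le> C * (2 + \<bar>c\<bar>) ^ M * (1 + \<bar>u\<bar>) ^ M"
proof -
  have "norm (\<Phi> (loop_point c u)) \<le> C * (1 + norm (loop_point c u)) ^ M"
    by (rule assms(1)[OF loop_point_in_region])
  also have "\<dots> \<le> C * ((2 + \<bar>c\<bar>) * (1 + \<bar>u\<bar>)) ^ M"
    using assms(2) by (intro mult_left_mono power_mono norm_loop_point) auto
  finally show ?thesis by (simp add: power_mult_distrib)
qed

definition loop_integrand :: "real \<Rightarrow> real \<Rightarrow> complex" where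
  "loop_integrand s u = \<Phi> (loop_point c u) * exp (- loop_point c u * of_real (ln s)) * loop_speed u"

text \<open>
  For \<open>s < 1\<close> the factor \<open>s\<^bsup>-z\<^esup>\<close> decays exponentially along both ends of the loop and outweighs the
  polynomial growth of \<open>\<Phi>\<close>.
\<close>
lemma integrable_loop_integrand:
  assumes s: "0 < s" "s < 1"
  shows "integrable lborel (loop_integrand s)"
proof -
  obtain C M where bound: "C > 0" "\<forall>z\<in>loop_region c. norm (\<Phi> z) \<le> C * (1 + norm z) ^ M"
    by (rule \<Phi>_bound)
  note C = bound(1) bound(2)[rule_format]
  define L where "L = - ln s"
  have L: "0 < L" using s by (simp add: L_def)
  define n where "n = M + 2"
  define B where "B = C * (2 + \<bar>c\<bar>) ^ M * exp ((c + 2) * L) * (real n / L) ^ n"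
  show ?thesis
  proof (rule integrable_inverse_square_dominated)
    show "loop_integrand s \<in> borel_measurable lborel"
      unfolding loop_integrand_def[abs_def] by measurable
    fix u :: real
    define v where "v = 1 + \<bar>u\<bar>"
    have v: "0 < v" by (simp add: v_def)
    have "Re (loop_point c u) \<le> c + 2 - v" by (simp add: loop_point_Re v_def)
    then have e1: "Re (loop_point c u) * L \<le> (c + 2 - v) * L" using L by (intro mult_right_mono) auto
    have "norm (exp (- loop_point c u * of_real (ln s))) = exp (Re (loop_point c u) * L)"
      by (simp add: L_def)
    also have "\<dots> \<le> exp ((c + 2) * L - L * v)" using e1 by (simp add: algebra_simps)
    also have "\<dots> = exp ((c + 2) * L) / exp (L * v)" by (rule exp_diff)
    finally have e2: "norm (exp (- loop_point c u * of_real (ln s))) \<le> exp ((c + 2) * L) / exp (L * v)" .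
    have powexp: "(L * v) ^ n \<le> real n ^ n * exp (L * v)"
      using L v by (intro power_le_exp) (auto simp: n_def)
    have e3: "v ^ M / exp (L * v) \<le> (real n / L) ^ n / v ^ 2"
    proof -
      have "v ^ M * (L ^ n * v ^ 2) \<le> real n ^ n * exp (L * v)"
        using powexp by (simp add: n_def power_mult_distrib power_add power2_eq_square mult_ac)
      then have "v ^ M \<le> real n ^ n * exp (L * v) / (L ^ n * v ^ 2)"
        using L v by (simp add: pos_le_divide_eq)
      then have "v ^ M / exp (L * v) \<le> (real n ^ n * exp (L * v) / (L ^ n * v ^ 2)) / exp (L * v)"
        by (intro divide_right_mono) auto
      then show ?thesis by (simp add: power_divide)
    qed
    have "norm (loop_integrand s u) = norm (\<Phi> (loop_point c u)) * norm (exp (- loop_point c u * of_real (ln s)))"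
      by (simp add: loop_integrand_def norm_mult)
    also have "\<dots> \<le> (C * (2 + \<bar>c\<bar>) ^ M * v ^ M) * (exp ((c + 2) * L) / exp (L * v))"
      unfolding v_def using C(1) by (intro mult_mono \<Phi>_loop_bound[OF C(2,1)] e2[unfolded v_def]) auto
    also have "\<dots> = (C * (2 + \<bar>c\<bar>) ^ M * exp ((c + 2) * L)) * (v ^ M / exp (L * v))" by simp
    also have "\<dots> \<le> (C * (2 + \<bar>c\<bar>) ^ M * exp ((c + 2) * L)) * ((real n / L) ^ n / v ^ 2)"
      using C(1) by (intro mult_left_mono e3) auto
    finally show "norm (loop_integrand s u) \<le> B / (1 + \<bar>u\<bar>) ^ 2"
      by (simp add: B_def v_def)
  qed
qed

lemma meijer_G_eq_loop_integral:
  assumes s: "0 < s" "s < 1"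
  shows "meijer_G q a b s = 1 / (2 * of_real pi * \<i>) * (\<integral>u. loop_integrand s u \<partial>lborel)"
proof -
  let ?f = "\<lambda>z. \<Phi> z * exp (- z * of_real (ln s))"
  have f: "meijer_integrand q a b s = ?f"
    using s by (intro ext) (simp add: meijer_integrand_eq powr_def Ln_of_real)
  have hol: "?f holomorphic_on {z. Im z \<noteq> 0 \<or> - \<alpha> < Re z}"
    by (intro holomorphic_intros holomorphic_\<Phi>)
  have "continuous_on (loop_trace c) ?f"
    using region_subset loop_trace_subset
    by (intro continuous_on_subset[OF holomorphic_on_imp_continuous_on[OF hol]]) blast
  then have "((\<lambda>R. contour_integral (loop_path c R) ?f) \<longlongrightarrow>
      (\<integral>u. ?f (loop_point c u) * loop_speed u \<partial>lborel)) at_top"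
    by (rule loop_integral_tendsto) (use integrable_loop_integrand[OF s] in \<open>simp add: loop_integrand_def[abs_def]\<close>)
  moreover have "contour_integral (loop_path (1 - \<alpha>) R) ?f = contour_integral (loop_path c R) ?f" for R
    by (rule contour_integral_loop_path_shift[OF hol]) (use c_gt_\<alpha> in auto)
  ultimately have "((\<lambda>R. contour_integral (loop_path (1 - \<alpha>) R) ?f) \<longlongrightarrow> (\<integral>u. loop_integrand s u \<partial>lborel)) at_top"
    by (simp add: loop_integrand_def)
  then have "Lim at_top (\<lambda>R. contour_integral (loop_path (1 - \<alpha>) R) ?f) = (\<integral>u. loop_integrand s u \<partial>lborel)"
    by (intro tendsto_Lim) auto
  then show ?thesis by (simp add: meijer_G_def f \<alpha>_def)
qed

text \<open>
  One difference more than the growth degree \<open>M\<close> leaves two orders of decay. The assumptions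
  \<open>p \<ge> 0 > c\<close> keep \<open>p - z\<close> in the right half-plane, at a distance from \<open>0\<close> growing linearly along the
  loop.
\<close>
lemma loop_kernel_bound:
  assumes C: "0 < C" "\<And>z. z \<in> loop_region c \<Longrightarrow> norm (\<Phi> z) \<le> C * (1 + norm z) ^ M" and p: "0 \<le> p"
  obtains B where "\<forall>u. norm (\<Phi> (loop_point c u)) *
     (real m ^ Suc M * fact (Suc M) / (p - Re (loop_point c u)) ^ Suc (Suc M)) \<le> B / (1 + \<bar>u\<bar>) ^ 2"
proof (rule that, rule allI)
  \<comment> \<open>Chosen so that \<open>e (1 + |u|) \<le> - c + max 0 (|u| - 1)\<close> on both the edge and the tails of the loop.\<close>
  define e where "e = min 1 (- c) / 2"
  have e: "0 < e" using c_neg by (simp add: e_def)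
  let ?B = "C * (2 + \<bar>c\<bar>) ^ M * (real m ^ Suc M * fact (Suc M)) / e ^ Suc (Suc M)"
  fix u :: real
  define v where "v = 1 + \<bar>u\<bar>"
  have v: "0 < v" by (simp add: v_def)
  have "e * v \<le> - c + max 0 (\<bar>u\<bar> - 1)"
  proof (cases "\<bar>u\<bar> \<le> 1")
    case True
    have "e * v \<le> e * 2" using True e by (intro mult_left_mono) (auto simp: v_def)
    then show ?thesis using True by (simp add: e_def)
  next
    case False
    have "e * (v - 2) \<le> 1 * (v - 2)" using False by (intro mult_right_mono) (auto simp: v_def e_def)
    moreover have "e * 2 \<le> - c" by (simp add: e_def)
    ultimately have "e * (v - 2) + e * 2 \<le> 1 * (v - 2) + (- c)" by (rule add_mono)
    also have "e * (v - 2) + e * 2 = e * v" by (simp add: algebra_simps)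
    finally show ?thesis using False by (simp add: v_def)
  qed
  then have le: "e * v \<le> p - Re (loop_point c u)" using p by (simp add: loop_point_Re)
  have "norm (\<Phi> (loop_point c u)) * (real m ^ Suc M * fact (Suc M) / (p - Re (loop_point c u)) ^ Suc (Suc M))
     \<le> (C * (2 + \<bar>c\<bar>) ^ M * v ^ M) * (real m ^ Suc M * fact (Suc M) / (e * v) ^ Suc (Suc M))"
  proof (rule mult_mono)
    show "norm (\<Phi> (loop_point c u)) \<le> C * (2 + \<bar>c\<bar>) ^ M * v ^ M"
      unfolding v_def by (rule \<Phi>_loop_bound[OF C(2,1)])
    have ev: "0 < e * v" using e v by simp
    show "real m ^ Suc M * fact (Suc M) / (p - Re (loop_point c u)) ^ Suc (Suc M) \<le> real m ^ Suc M * fact (Suc M) / (e * v) ^ Suc (Suc M)"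
      using le ev by (intro divide_left_mono power_mono mult_pos_pos[OF zero_less_power zero_less_power]) auto
    show "0 \<le> real m ^ Suc M * fact (Suc M) / (p - Re (loop_point c u)) ^ Suc (Suc M)"
      using le ev by (intro divide_nonneg_nonneg zero_le_power mult_nonneg_nonneg) auto
  qed (use C v in auto)
  also have "\<dots> = ?B / v ^ 2"
    using v e by (simp add: power_mult_distrib field_simps power2_eq_square)
  finally show "norm (\<Phi> (loop_point c u)) *
     (real m ^ Suc M * fact (Suc M) / (p - Re (loop_point c u)) ^ Suc (Suc M)) \<le> ?B / (1 + \<bar>u\<bar>) ^ 2"
    by (simp add: v_def)
qed

text \<open>
  Insert the loop integral for the \<open>G\<close>-function and integrate over \<open>s\<close> first. The inner integral is
  the iterated difference of the Cauchy kernel, and the remaining loop integral is evaluated by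
  residues.
\<close>
lemma meijer_G_difference_moment:
  obtains N where "0 < N"
    "\<forall>m. \<forall>p\<ge>0. has_bochner_integral lborel
       (\<lambda>s. (indicator {0<..<1} s * (1 - s ^ m) ^ N * exp ((p - 1) * ln s)) *\<^sub>R meijer_G q a b s)
       (\<Sum>k\<le>N. (-1) ^ k * of_nat (N choose k) * \<Phi> (of_real (p + real (k * m))))"
proof -
  obtain C M where bound: "C > 0" "\<forall>z\<in>loop_region c. norm (\<Phi> z) \<le> C * (1 + norm z) ^ M"
    by (rule \<Phi>_bound)
  note C = bound(1) bound(2)[rule_format]
  let ?N = "Suc M"
  have "has_bochner_integral lborel
       (\<lambda>s. (indicator {0<..<1} s * (1 - s ^ m) ^ ?N * exp ((p - 1) * ln s)) *\<^sub>R meijer_G q a b s)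
       (\<Sum>k\<le>?N. (-1) ^ k * of_nat (?N choose k) * \<Phi> (of_real (p + real (k * m))))" if p: "0 \<le> p" for m p
  proof -
    define S where "S = (\<Sum>k\<le>?N. (-1) ^ k * of_nat (?N choose k) * \<Phi> (of_real (p + real (k * m))))"
    define h where "h = (\<lambda>s. indicator {0<..<1} s * (1 - s ^ m) ^ ?N :: real)"
    define w where "w = (\<lambda>u. of_real p - loop_point c u)"
    define f where "f = (\<lambda>u s. (\<Phi> (loop_point c u) * loop_speed u) * (h s *\<^sub>R exp ((w u - 1) * of_real (ln s))))"
    define g where "g = (\<lambda>z. \<Phi> z * diff_kernel ?N m (of_real p - z))"
    have h_nonneg: "0 \<le> h s" for s
      by (auto simp: h_def indicator_def power_le_one simp del: power_Suc)
    have h_meas [measurable]: "h \<in> borel_measurable borel" unfolding h_def by measurable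
    have w_meas [measurable]: "w \<in> borel_measurable borel" unfolding w_def by measurable
    have w: "0 < Re (w u)" for u using p c_neg by (simp add: w_def loop_point_Re)
    have wRe: "Re (w u) = p - Re (loop_point c u)" for u by (simp add: w_def)
    obtain B where B: "\<forall>u. norm (\<Phi> (loop_point c u)) *
       (real m ^ ?N * fact ?N / (p - Re (loop_point c u)) ^ Suc ?N) \<le> B / (1 + \<bar>u\<bar>) ^ 2"
      by (rule loop_kernel_bound[OF C p])
    have inner: "has_bochner_integral lborel (f u) (g (loop_point c u) * loop_speed u)" for u
    proof -
      have "has_bochner_integral lborel (f u) ((\<Phi> (loop_point c u) * loop_speed u) * diff_kernel ?N m (w u))"
        unfolding f_def h_def by (intro has_bochner_integral_mult_right has_bochner_integral_diff_kernel w)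
      then show ?thesis by (simp add: g_def w_def mult_ac)
    qed
    have norm_inner: "(\<integral>s. norm (f u s) \<partial>lborel) \<le> B / (1 + \<bar>u\<bar>) ^ 2" for u
    proof -
      let ?r = "Re (w u)"
      have "has_bochner_integral lborel (\<lambda>s. complex_of_real (h s * exp ((?r - 1) * ln s))) (diff_kernel ?N m (of_real ?r))"
        using has_bochner_integral_diff_kernel[of "of_real ?r" m ?N] w[of u]
        by (simp add: h_def scaleR_conv_of_real flip: exp_of_real)
      then have "norm (\<integral>s. complex_of_real (h s * exp ((?r - 1) * ln s)) \<partial>lborel) = norm (diff_kernel ?N m (complex_of_real ?r))"
        by (simp add: has_bochner_integral_iff)
      then have "\<bar>\<integral>s. h s * exp ((?r - 1) * ln s) \<partial>lborel\<bar> \<le> real m ^ ?N * fact ?N / ?r ^ Suc ?N"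
        using norm_diff_kernel_le[of "of_real ?r" ?N m] w[of u]
        by (simp only: integral_complex_of_real norm_of_real Re_complex_of_real)
      then have int: "(\<integral>s. h s * exp ((?r - 1) * ln s) \<partial>lborel) \<le> real m ^ ?N * fact ?N / ?r ^ Suc ?N"
        by linarith
      have "norm (f u s) = norm (\<Phi> (loop_point c u)) * (h s * exp ((?r - 1) * ln s))" for s
        using h_nonneg[of s] by (simp add: f_def norm_mult)
      then have "(\<integral>s. norm (f u s) \<partial>lborel) = norm (\<Phi> (loop_point c u)) * (\<integral>s. h s * exp ((?r - 1) * ln s) \<partial>lborel)"
        by simp
      also have "\<dots> \<le> norm (\<Phi> (loop_point c u)) * (real m ^ ?N * fact ?N / ?r ^ Suc ?N)"
        by (intro mult_left_mono int) auto
      also have "\<dots> \<le> B / (1 + \<bar>u\<bar>) ^ 2" unfolding wRe by (rule B[rule_format])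
      finally show ?thesis .
    qed
    have meas [measurable]: "case_prod f \<in> borel_measurable (lborel \<Otimes>\<^sub>M lborel)"
      unfolding f_def by measurable
    have prod_int: "integrable (lborel \<Otimes>\<^sub>M lborel) (case_prod f)"
    proof (rule lborel_pair.Fubini_integrable[OF meas])
      have "integrable lborel (\<lambda>u. complex_of_real (\<integral>s. norm (f u s) \<partial>lborel))"
      proof (rule integrable_inverse_square_dominated)
        show "(\<lambda>u. complex_of_real (\<integral>s. norm (f u s) \<partial>lborel)) \<in> borel_measurable lborel" by measurable
        show "norm (complex_of_real (\<integral>s. norm (f u s) \<partial>lborel)) \<le> B / (1 + \<bar>u\<bar>) ^ 2" for u
          using norm_inner[of u] by (simp add: integral_nonneg_AE)
      qed
      then show "integrable lborel (\<lambda>u. \<integral>s. norm (case (u, s) of (u, s) \<Rightarrow> f u s) \<partial>lborel)"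
        by (simp only: complex_of_real_integrable_eq prod.case)
      show "AE u in lborel. integrable lborel (\<lambda>s. case (u, s) of (u, s) \<Rightarrow> f u s)"
        using inner by (auto simp: has_bochner_integral_iff)
    qed
    have g_int: "integrable lborel (\<lambda>u. g (loop_point c u) * loop_speed u)"
      using lborel_pair.integrable_fst[OF prod_int] inner by (simp add: has_bochner_integral_iff)
    have g_val: "(\<integral>u. g (loop_point c u) * loop_speed u \<partial>lborel) = 2 * pi * \<i> * S"
    proof (rule tendsto_unique)
      have nz: "of_real p - z + of_nat (k * m) \<noteq> 0" if "z \<in> loop_trace c" for z k
      proof -
        have "0 < Re (of_real p - z) + real (k * m)"
          using that p c_neg of_nat_0_le_iff[of "k * m"] unfolding loop_trace_def
          by (intro add_pos_nonneg) auto
        then show ?thesis by (auto simp: complex_eq_iff simp del: of_nat_mult)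
      qed
      show "((\<lambda>R. contour_integral (loop_path c R) g) \<longlongrightarrow> (\<integral>u. g (loop_point c u) * loop_speed u \<partial>lborel)) at_top"
      proof (rule loop_integral_tendsto[OF _ g_int])
        have "continuous_on (loop_trace c) \<Phi>"
          by (rule continuous_on_subset[OF continuous_\<Phi> loop_trace_subset])
        then show "continuous_on (loop_trace c) g"
          unfolding g_def diff_kernel_def using nz by (intro continuous_intros) auto
      qed
      obtain D where D: "D > 0" "\<forall>z :: complex. 2 * (p + real (?N * m)) \<le> norm z \<and> 0 < norm z \<longrightarrow>
         norm (diff_kernel ?N m (of_real p - z)) \<le> D / norm z ^ Suc ?N"
        by (rule diff_kernel_decay[OF p])
      show "((\<lambda>R. contour_integral (loop_path c R) g) \<longlongrightarrow> 2 * pi * \<i> * S) at_top"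
        unfolding g_def S_def
      proof (rule loop_integral_by_residues[OF holomorphic_\<Phi> c_gt_\<alpha>])
        show "c < p" using p c_neg by simp
        show "0 \<le> C * 2 ^ M * D" using C D by simp
        fix z assume z: "z \<in> loop_region c" "1 + 2 * (p + real (?N * m)) \<le> norm z"
        have "0 \<le> 2 * (p + real (?N * m))"
          using p by (intro mult_nonneg_nonneg add_nonneg_nonneg of_nat_0_le_iff) auto
        then have zK: "2 * (p + real (?N * m)) \<le> norm z" and nz: "1 \<le> norm z"
          using order.trans[OF _ z(2)] by auto
        have "norm (\<Phi> z) \<le> C * (1 + norm z) ^ M" by (rule C(2)[OF z(1)])
        also have "\<dots> \<le> C * (2 * norm z) ^ M"
          using C(1) nz by (intro mult_left_mono power_mono) auto
        finally have "norm (\<Phi> z) * norm (diff_kernel ?N m (of_real p - z)) \<le>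
            (C * (2 * norm z) ^ M) * (D / norm z ^ Suc ?N)"
          using zK nz D C by (intro mult_mono D(2)[rule_format]) auto
        also have "\<dots> = C * 2 ^ M * D / norm z ^ 2"
        proof -
          have "norm z \<noteq> 0" using nz by auto
          then show ?thesis by (simp add: power_mult_distrib power2_eq_square)
        qed
        finally show "norm (\<Phi> z * diff_kernel ?N m (of_real p - z)) \<le> C * 2 ^ M * D / norm z ^ 2"
          by (simp add: norm_mult)
      qed
    qed simp
    have f_eq: "(\<integral>u. f u s \<partial>lborel) = 2 * pi * \<i> * ((h s * exp ((p - 1) * ln s)) *\<^sub>R meijer_G q a b s)" for s
    proof (cases "s \<in> {0<..<1}")
      case True
      have "f u s = (h s * exp ((p - 1) * ln s)) *\<^sub>R loop_integrand s u" for u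
      proof -
        have "exp ((w u - 1) * of_real (ln s)) = of_real (exp ((p - 1) * ln s)) * exp (- loop_point c u * of_real (ln s))"
          by (simp add: w_def exp_of_real[symmetric] exp_add[symmetric] algebra_simps)
        then show ?thesis
          by (simp add: f_def loop_integrand_def scaleR_conv_of_real)
      qed
      then have "(\<integral>u. f u s \<partial>lborel) = (h s * exp ((p - 1) * ln s)) *\<^sub>R (\<integral>u. loop_integrand s u \<partial>lborel)"
        by simp
      then show ?thesis
        using True meijer_G_eq_loop_integral[of s] by (simp add: field_simps)
    qed (simp add: f_def h_def)
    have int_s: "integrable lborel (\<lambda>s. \<integral>u. f u s \<partial>lborel)"
      by (rule lborel_pair.integrable_snd[OF prod_int])
    have "(\<integral>s. (\<integral>u. f u s \<partial>lborel) \<partial>lborel) = (\<integral>u. (\<integral>s. f u s \<partial>lborel) \<partial>lborel)"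
      by (rule lborel_pair.Fubini_integral[OF prod_int])
    also have "\<dots> = 2 * pi * \<i> * S"
      using g_val inner by (simp add: has_bochner_integral_iff)
    finally have "has_bochner_integral lborel
       (\<lambda>s. 2 * pi * \<i> * ((h s * exp ((p - 1) * ln s)) *\<^sub>R meijer_G q a b s)) (2 * pi * \<i> * S)"
      using int_s unfolding f_eq has_bochner_integral_iff by blast
    then have "has_bochner_integral lborel
       (\<lambda>s. (1 / (2 * pi * \<i>)) * (2 * pi * \<i> * ((h s * exp ((p - 1) * ln s)) *\<^sub>R meijer_G q a b s))) ((1 / (2 * pi * \<i>)) * (2 * pi * \<i> * S))"
      by (rule has_bochner_integral_mult_right)
    then show ?thesis by (simp add: h_def S_def)
  qed
  then show ?thesis using that[of ?N] by blast
qed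

end

context meijer_parameters
begin

text \<open>
  Let \<open>m\<close> tend to infinity in the previous moments. On \<open>(0,1)\<close> the weights \<open>(1 - s\<^sup>m)\<^sup>N\<close> increase to \<open>1\<close>, so
  nonnegativity gives convergence of the integrals and integrability of the limit.
\<close>
lemma meijer_G_moment:
  assumes nonneg: "\<And>s. 0 < s \<Longrightarrow> s < 1 \<Longrightarrow> meijer_G q a b s \<in> \<real>\<^sub>\<ge>\<^sub>0" and p: "0 \<le> p"
  shows "has_bochner_integral lborel
    (\<lambda>s. indicator {0<..<1} s * exp ((p - 1) * ln s) * Re (meijer_G q a b s))
    (gamma_ratio q a b p - (if (\<Sum>i=1..q. a i) = (\<Sum>i=1..q. b i) then 1 else 0))"
proof -
  obtain N where N: "0 < N" and moment:
    "\<forall>m. \<forall>p\<ge>0. has_bochner_integral lborel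
       (\<lambda>s. (indicator {0<..<1} s * (1 - s ^ m) ^ N * exp ((p - 1) * ln s)) *\<^sub>R meijer_G q a b s)
       (\<Sum>k\<le>N. (-1) ^ k * of_nat (N choose k) * \<Phi> (of_real (p + real (k * m))))"
    by (rule meijer_G_difference_moment)
  define \<kappa> :: real where "\<kappa> = (if (\<Sum>i=1..q. a i) = (\<Sum>i=1..q. b i) then 1 else 0)"
  \<comment> \<open>\<open>Suc m\<close> in place of \<open>m\<close>, because for \<open>m = 0\<close> the points \<open>p + k m\<close> would not move.\<close>
  define f where "f = (\<lambda>m s. indicator {0<..<1} s * (1 - s ^ Suc m) ^ N * exp ((p - 1) * ln s) * Re (meijer_G q a b s) :: real)"
  define u where "u = (\<lambda>s. indicator {0<..<1} s * exp ((p - 1) * ln s) * Re (meijer_G q a b s) :: real)"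
  define S where "S = (\<lambda>m. \<Sum>k\<le>N. (-1) ^ k * real (N choose k) * gamma_ratio q a b (p + real (k * Suc m)))"
  have f: "has_bochner_integral lborel (f m) (S m)" for m
  proof -
    have "has_bochner_integral lborel
       (\<lambda>s. Re ((indicator {0<..<1} s * (1 - s ^ Suc m) ^ N * exp ((p - 1) * ln s)) *\<^sub>R meijer_G q a b s))
       (Re (\<Sum>k\<le>N. (-1) ^ k * of_nat (N choose k) * \<Phi> (of_real (p + real (k * Suc m)))))"
      by (intro has_bochner_integral_bounded_linear[OF bounded_linear_Re] moment[rule_format] p)
    moreover have "(\<Sum>k\<le>N. (-1) ^ k * of_nat (N choose k) * \<Phi> (of_real (p + real (k * Suc m)))) = of_real (S m)"
      unfolding gamma_ratio_of_real S_def by simp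
    ultimately have "has_bochner_integral lborel
       (\<lambda>s. Re ((indicator {0<..<1} s * (1 - s ^ Suc m) ^ N * exp ((p - 1) * ln s)) *\<^sub>R meijer_G q a b s)) (Re (of_real (S m)))"
      by (simp only:)
    then show ?thesis by (simp add: f_def)
  qed
  have \<rho>: "0 \<le> Re (meijer_G q a b s)" if "s \<in> {0<..<1}" for s
    using nonneg[of s] that by (auto simp: complex_nonneg_Reals_iff)
  have lim: "(\<lambda>m. f m s) \<longlonglongrightarrow> u s" for s
  proof (cases "s \<in> {0<..<1}")
    case True
    then have "(\<lambda>m. s ^ Suc m) \<longlonglongrightarrow> 0" by (intro LIMSEQ_Suc LIMSEQ_power_zero) auto
    then have "(\<lambda>m. f m s) \<longlonglongrightarrow> indicator {0<..<1} s * (1 - 0) ^ N * exp ((p - 1) * ln s) * Re (meijer_G q a b s)"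
      unfolding f_def by (intro tendsto_intros)
    then show ?thesis by (simp add: u_def)
  qed (simp add: f_def u_def)
  have S_lim: "S \<longlonglongrightarrow> gamma_ratio q a b p - \<kappa>"
  proof -
    have term_lim: "(\<lambda>m. gamma_ratio q a b (p + real (k * Suc m))) \<longlonglongrightarrow> (if k = 0 then gamma_ratio q a b p else \<kappa>)" for k
    proof (cases "k = 0")
      case False
      have "(\<lambda>n. gamma_ratio q a b (p + real n)) \<longlonglongrightarrow> \<kappa>"
        unfolding \<kappa>_def by (rule gamma_ratio_tendsto[OF a_pos b_pos p sum_le])
      moreover have "filterlim (\<lambda>m. k * Suc m) at_top sequentially"
        using False by (intro filterlim_subseq) (auto simp: strict_mono_def)
      ultimately show ?thesis using False by (auto dest: filterlim_compose)
    qed simp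
    have "S \<longlonglongrightarrow> (\<Sum>k\<le>N. (-1) ^ k * real (N choose k) * (if k = 0 then gamma_ratio q a b p else \<kappa>))"
      unfolding S_def by (intro tendsto_intros term_lim)
    also have "(\<Sum>k\<le>N. (-1) ^ k * real (N choose k) * (if k = 0 then gamma_ratio q a b p else \<kappa>)) =
       (\<Sum>k\<le>N. (-1) ^ k * real (N choose k) * \<kappa> + (if k = 0 then gamma_ratio q a b p - \<kappa> else 0))"
      by (intro sum.cong refl) (auto simp: algebra_simps)
    also have "\<dots> = (\<Sum>k\<le>N. (-1) ^ k * real (N choose k)) * \<kappa> + (gamma_ratio q a b p - \<kappa>)"
      by (simp add: sum.distrib sum_distrib_right)
    also have "\<dots> = gamma_ratio q a b p - \<kappa>"
      using choose_alternating_sum[OF N, where 'a = real] by simp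
    finally show ?thesis .
  qed
  have mono: "mono (\<lambda>m. f m s)" for s
  proof (cases "s \<in> {0<..<1}")
    case True
    have "f m s \<le> f n s" if "m \<le> n" for m n
    proof -
      have "s ^ Suc n \<le> s ^ Suc m" using True that by (intro power_decreasing) auto
      moreover have "s ^ Suc m \<le> 1" using True by (intro power_le_one) auto
      ultimately have "(1 - s ^ Suc m) ^ N \<le> (1 - s ^ Suc n) ^ N"
        by (intro power_mono) linarith+
      then show ?thesis
        unfolding f_def using True \<rho>[OF True] by (intro mult_right_mono mult_left_mono) auto
    qed
    then show ?thesis by (rule monoI)
  qed (auto simp: f_def monoI)
  have f_nonneg: "0 \<le> f m s" for m s
    using \<rho>[of s] by (auto simp: f_def indicator_def power_le_one simp del: power_Suc intro!: mult_nonneg_nonneg)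
  have u_meas: "u \<in> borel_measurable lborel"
    by (rule borel_measurable_LIMSEQ_real[OF lim borel_measurable_integrable])
      (use f in \<open>simp add: has_bochner_integral_iff\<close>)
  have "integrable lborel u" "integral\<^sup>L lborel u = gamma_ratio q a b p - \<kappa>"
    by (rule integral_monotone_convergence_nonneg[where f = f];
        use f mono f_nonneg lim S_lim u_meas in \<open>simp add: has_bochner_integral_iff\<close>)+
  then show ?thesis by (simp add: has_bochner_integral_iff u_def \<kappa>_def)
qed

end

text \<open>
  A finite measure on \<open>(0,1]\<close>, presented as the distribution of \<open>X\<close>. In this form a change of the
  weight is a change of the density on the underlying space, and \<open>X\<close> may take the value \<open>1\<close> on a set
  that represents a point mass.
\<close>
locale unit_interval_variable = finite_measure M for M :: "'a measure" +
  fixes X :: "'a \<Rightarrow> real"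
  assumes X_measurable [measurable]: "X \<in> borel_measurable M"
    and X_pos: "\<And>\<omega>. 0 < X \<omega>" and X_le: "\<And>\<omega>. X \<omega> \<le> 1"

text \<open>
  The interval \<open>[1,2]\<close>, on which \<open>X\<close> is \<open>1\<close>, carries the point mass at \<open>1\<close>, so that the measure has a
  density with respect to Lebesgue measure. The value \<open>1\<close> of \<open>X\<close> outside \<open>(0,1)\<close> keeps \<open>X\<close> positive
  everywhere.
\<close>
lemma (in meijer_parameters) mixing_measure:
  assumes nonneg: "\<And>s. 0 < s \<Longrightarrow> s < 1 \<Longrightarrow> meijer_G q a b s \<in> \<real>\<^sub>\<ge>\<^sub>0"
  obtains M :: "real measure" and X where "unit_interval_variable M X"
    "\<forall>p\<ge>0. (\<integral>u. X u powr p \<partial>M) = gamma_ratio q a b p"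
proof -
  define \<kappa> :: real where "\<kappa> = (if (\<Sum>i=1..q. a i) = (\<Sum>i=1..q. b i) then 1 else 0)"
  define \<rho> where "\<rho> = (\<lambda>s. indicator {0<..<1} s * exp ((0 - 1) * ln s) * Re (meijer_G q a b s) :: real)"
  define h where "h = (\<lambda>u. \<rho> u + \<kappa> * indicator {1..2} u)"
  define X where "X = (\<lambda>u::real. if 0 < u \<and> u < 1 then u else 1)"
  define M where "M = density lborel (\<lambda>u. ennreal (h u))"
  have \<rho>_int: "integrable lborel \<rho>"
    using meijer_G_moment[OF nonneg order.refl] unfolding \<rho>_def has_bochner_integral_iff by blast
  have h_int: "integrable lborel h"
    unfolding h_def by (intro Bochner_Integration.integrable_add \<rho>_int integrable_mult_right integrable_real_indicator) auto
  have h_meas [measurable]: "h \<in> borel_measurable borel"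
    using borel_measurable_integrable[OF h_int] by simp
  have \<rho>_nonneg: "0 \<le> \<rho> u" for u
    using nonneg[of u] by (auto simp: \<rho>_def complex_nonneg_Reals_iff indicator_def)
  have h_nonneg: "0 \<le> h u" for u
    using \<rho>_nonneg[of u] by (simp add: h_def \<kappa>_def)
  have X_meas [measurable]: "X \<in> borel_measurable borel"
    unfolding X_def by measurable
  have "unit_interval_variable M X"
  proof (intro unit_interval_variable.intro finite_measureI unit_interval_variable_axioms.intro)
    have "emeasure M (space M) = (\<integral>\<^sup>+ u. ennreal (h u) \<partial>lborel)"
      unfolding M_def by (subst emeasure_density) auto
    also have "\<dots> = ennreal (integral\<^sup>L lborel h)"
      by (rule nn_integral_eq_integral[OF h_int]) (simp add: h_nonneg)
    finally show "emeasure M (space M) \<noteq> \<infinity>" by simp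
    show "X \<in> borel_measurable M" by (simp add: M_def)
  qed (auto simp: X_def)
  moreover have "\<forall>p\<ge>0. (\<integral>u. X u powr p \<partial>M) = gamma_ratio q a b p"
  proof (intro allI impI)
    fix p :: real assume p: "0 \<le> p"
    have "(\<integral>u. X u powr p \<partial>M) = (\<integral>u. h u * X u powr p \<partial>lborel)"
      unfolding M_def by (subst integral_real_density) (auto simp: h_nonneg)
    also have "(\<lambda>u. h u * X u powr p) =
       (\<lambda>u. indicator {0<..<1} u * exp ((p - 1) * ln u) * Re (meijer_G q a b u) + \<kappa> * indicator {1..2} u)"
      by (rule ext) (auto simp: h_def \<rho>_def X_def powr_def indicator_def exp_add[symmetric] algebra_simps)
    also have "(\<integral>u. indicator {0<..<1} u * exp ((p - 1) * ln u) * Re (meijer_G q a b u) + \<kappa> * indicator {1..2} u \<partial>lborel)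
       = (gamma_ratio q a b p - \<kappa>) + \<kappa> * 1"
      using meijer_G_moment[OF nonneg p] unfolding \<kappa>_def[symmetric]
      by (subst Bochner_Integration.integral_add) (auto simp: has_bochner_integral_iff)
    finally show "(\<integral>u. X u powr p \<partial>M) = gamma_ratio q a b p" by simp
  qed
  ultimately show ?thesis by (rule that)
qed

section \<open>Hypergeometric functions as mixtures of powers\<close>

lemma open_cut_plane: "open cut_plane"
proof -
  have "complex_of_real ` {1..} = {z. Im z = 0} \<inter> {z. 1 \<le> Re z}"
    by (auto simp: complex_eq_iff image_iff)
  moreover have "closed ({z. Im z = 0} \<inter> {z. 1 \<le> Re z})"
    by (intro closed_Int closed_Collect_eq closed_Collect_le continuous_intros)
  ultimately have "closed (complex_of_real ` {1..})" by simp
  then show ?thesis unfolding cut_plane_def by (rule open_Compl)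
qed

lemma of_real_in_cut_plane_iff: "complex_of_real r \<in> cut_plane \<longleftrightarrow> r < 1"
  by (auto simp: cut_plane_def)

lemma cut_plane_ray:
  assumes "z \<in> cut_plane" "0 \<le> t" "t \<le> 1"
  shows "of_real t * z \<in> cut_plane"
proof (rule ccontr)
  assume "of_real t * z \<notin> cut_plane"
  then obtain r where r: "1 \<le> r" "of_real t * z = of_real r" by (auto simp: cut_plane_def)
  have t: "t \<noteq> 0" using r by auto
  have "z = of_real (r / t)" using r(2) t by (simp add: field_simps)
  moreover have "1 \<le> r / t" using r t assms by (simp add: pos_le_divide_eq)
  ultimately show False using assms(1) of_real_in_cut_plane_iff[of "r / t"] by simp
qed

text \<open>
  For these \<open>z\<close> and \<open>x\<close> the principal power of \<open>1 - z x\<close> is holomorphic in \<open>z\<close>.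
\<close>
lemma one_minus_cut_plane:
  assumes "z \<in> cut_plane" "0 \<le> x" "x \<le> 1"
  shows "1 - z * of_real x \<notin> \<real>\<^sub>\<le>\<^sub>0"
proof
  assume "1 - z * of_real x \<in> \<real>\<^sub>\<le>\<^sub>0"
  then obtain r where r: "r \<le> 0" "1 - z * of_real x = of_real r" by (auto elim: nonpos_Reals_cases)
  have "of_real x * z = of_real (1 - r)" using r(2) by (simp add: algebra_simps)
  moreover have "of_real (1 - r) \<notin> cut_plane" using r(1) unfolding of_real_in_cut_plane_iff by simp
  ultimately show False using cut_plane_ray[OF assms] by simp
qed

lemma connected_cut_plane: "connected cut_plane"
proof (rule starlike_imp_connected)
  have "0 \<in> cut_plane" by (auto simp: cut_plane_def)
  moreover have "closed_segment 0 z \<subseteq> cut_plane" if "z \<in> cut_plane" for z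
    using cut_plane_ray[OF that] by (auto simp: closed_segment_def scaleR_conv_of_real)
  ultimately show "starlike cut_plane" unfolding starlike_def by blast
qed

lemma unit_ball_cut_plane: "ball 0 1 \<subseteq> cut_plane"
  by (auto simp: cut_plane_def)

lemma continuous_on_powr_slit:
  fixes f :: "'a :: topological_space \<Rightarrow> complex"
  assumes "continuous_on A f" "\<And>x. x \<in> A \<Longrightarrow> f x \<notin> \<real>\<^sub>\<le>\<^sub>0"
  shows "continuous_on A (\<lambda>x. f x powr s)"
proof (rule continuous_on_powr_complex)
  have "0 < Re (f x) \<or> Im (f x) \<noteq> 0" if "x \<in> A" for x
    using assms(2)[OF that] by (auto simp: complex_nonpos_Reals_iff)
  then show "A \<subseteq> {x. Re (f x) \<ge> 0 \<or> Im (f x) \<noteq> 0}" by (auto intro: less_imp_le)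
  show "0 < Re s" if "x \<in> A" "f x = 0" for x
    using assms(2)[OF that(1)] that(2) by simp
qed (intro assms(1) continuous_on_const)+

context unit_interval_variable
begin

lemma integrable_continuous:
  fixes h :: "real \<Rightarrow> 'c :: {banach, second_countable_topology}"
  assumes cont: "continuous_on {0..1} h"
  shows "integrable M (\<lambda>\<omega>. h (X \<omega>))"
proof -
  let ?g = "\<lambda>x. h (max 0 (min 1 x))"
  have g: "h (X \<omega>) = ?g (X \<omega>)" for \<omega> using X_pos[of \<omega>] X_le[of \<omega>] by simp
  have "continuous_on UNIV ?g"
    by (rule continuous_on_compose2[OF cont]) (auto intro!: continuous_intros)
  then have [measurable]: "?g \<in> borel_measurable borel" by (rule borel_measurable_continuous_onI)
  have "bounded (h ` {0..1})"
    by (intro compact_imp_bounded compact_continuous_image cont) simp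
  then obtain B where "\<forall>x\<in>{0..1}. norm (h x) \<le> B" by (auto simp: bounded_iff)
  then have "norm (h (X \<omega>)) \<le> B" for \<omega> using X_pos[of \<omega>] X_le[of \<omega>] by simp
  moreover have "(\<lambda>\<omega>. h (X \<omega>)) \<in> borel_measurable M" unfolding g by measurable
  ultimately show ?thesis by (intro integrable_const_bound[where B = B]) auto
qed

definition power_mixture :: "real \<Rightarrow> complex \<Rightarrow> complex" where
  "power_mixture \<sigma> y = (\<integral>\<omega>. (1 - y * of_real (X \<omega>)) powr (- of_real \<sigma>) \<partial>M)"

lemma continuous_power_kernel:
  assumes "z \<in> cut_plane"
  shows "continuous_on {0..1} (\<lambda>x. (1 - z * of_real x) powr s)"
  using one_minus_cut_plane[OF assms] by (intro continuous_on_powr_slit continuous_intros) auto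

text \<open>
  The binomial series, integrated term by term. It is dominated by the series at \<open>|y|\<close>, which
  converges absolutely.
\<close>
lemma power_mixture_sums:
  assumes y: "norm y < 1"
  shows "(\<lambda>n. of_real (pochhammer \<sigma> n * (\<integral>\<omega>. X \<omega> ^ n \<partial>M)) * y ^ n / fact n) sums power_mixture \<sigma> y"
proof -
  let ?c = "\<lambda>n. (- complex_of_real \<sigma>) gchoose n"
  define f where "f = (\<lambda>n \<omega>. ?c n * (- (y * of_real (X \<omega>))) ^ n)"
  have X1: "norm (- (y * of_real (X \<omega>))) \<le> norm y" for \<omega>
    using X_pos[of \<omega>] X_le[of \<omega>] by (simp add: norm_mult mult_left_le)
  have sums: "(\<lambda>n. f n \<omega>) sums ((1 - y * of_real (X \<omega>)) powr (- of_real \<sigma>))" for \<omega>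
    using gen_binomial_complex[of "- (y * of_real (X \<omega>))" "- of_real \<sigma>"] X1[of \<omega>] y by (simp add: f_def)
  have conv: "ereal (norm y) < conv_radius ?c"
    using y by (simp add: conv_radius_gchoose)
  have summ: "summable (\<lambda>n. norm (?c n * y ^ n))"
    using conv by (intro abs_summable_in_conv_radius) simp
  have bound: "norm (f n \<omega>) \<le> norm (?c n * y ^ n)" for n \<omega>
    unfolding f_def norm_mult norm_power using X1[of \<omega>] by (intro mult_left_mono power_mono) auto
  have int: "integrable M (f n)" for n
    unfolding f_def by (intro integrable_continuous[of "\<lambda>x. ?c n * (- (y * of_real x)) ^ n"] continuous_intros)
  have "(\<lambda>n. integral\<^sup>L M (f n)) sums (\<integral>\<omega>. (\<Sum>n. f n \<omega>) \<partial>M)"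
  proof (rule sums_integral[OF int])
    show "AE \<omega> in M. summable (\<lambda>n. norm (f n \<omega>))"
      by (intro AE_I2 summable_comparison_test[OF _ summ] exI[of _ 0]) (use bound in auto)
    show "summable (\<lambda>n. \<integral>\<omega>. norm (f n \<omega>) \<partial>M)"
    proof (rule summable_comparison_test[OF _ summable_mult2[OF summ, of "measure M (space M)"]], intro exI[of _ 0] allI impI)
      fix n
      have "(\<integral>\<omega>. norm (f n \<omega>) \<partial>M) \<le> (\<integral>\<omega>. norm (?c n * y ^ n) \<partial>M)"
        using int[of n] bound by (intro integral_mono) auto
      then show "norm (\<integral>\<omega>. norm (f n \<omega>) \<partial>M) \<le> norm (?c n * y ^ n) * measure M (space M)"
        by (simp add: mult.commute)
    qed
  qed
  also have "(\<lambda>\<omega>. \<Sum>n. f n \<omega>) = (\<lambda>\<omega>. (1 - y * of_real (X \<omega>)) powr (- of_real \<sigma>))"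
    using sums by (simp add: sums_iff)
  also have "(\<lambda>n. integral\<^sup>L M (f n)) = (\<lambda>n. of_real (pochhammer \<sigma> n * (\<integral>\<omega>. X \<omega> ^ n \<partial>M)) * y ^ n / fact n)"
  proof
    fix n
    have f_eq: "f n \<omega> = (of_real (pochhammer \<sigma> n) * y ^ n / fact n) * of_real (X \<omega> ^ n)" for \<omega>
    proof -
      have sq: "(-1) ^ n * (-1) ^ n = (1 :: complex)" by (simp flip: power_mult_distrib)
      have c: "?c n = (-1) ^ n * of_real (pochhammer \<sigma> n) / fact n"
        by (simp add: gbinomial_pochhammer pochhammer_of_real)
      have x: "(- (y * of_real (X \<omega>))) ^ n = (-1) ^ n * (y ^ n * of_real (X \<omega> ^ n))"
        by (simp add: power_minus[of "y * of_real (X \<omega>)"] power_mult_distrib)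
      have "f n \<omega> = ((-1) ^ n * (-1) ^ n) * ((of_real (pochhammer \<sigma> n) * y ^ n / fact n) * of_real (X \<omega> ^ n))"
        unfolding f_def c x by (simp add: mult_ac divide_inverse)
      then show ?thesis by (simp only: sq mult_1)
    qed
    have "integral\<^sup>L M (f n) = (of_real (pochhammer \<sigma> n) * y ^ n / fact n) * (\<integral>\<omega>. of_real (X \<omega> ^ n) \<partial>M)"
      unfolding f_eq by (rule integral_mult_right_zero)
    then show "integral\<^sup>L M (f n) = of_real (pochhammer \<sigma> n * (\<integral>\<omega>. X \<omega> ^ n \<partial>M)) * y ^ n / fact n"
      by (simp only: integral_complex_of_real) (simp add: field_simps)
  qed
  finally show ?thesis by (simp add: power_mixture_def)
qed

text \<open>
  The kernel is Lipschitz in \<open>y\<close> near any point of the cut plane, uniformly over \<open>x\<close> in \<open>[0,1]\<close>, because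
  its derivative is bounded on a compact set. So dominated convergence applies to the difference
  quotients.
\<close>
lemma power_mixture_has_derivative:
  assumes y: "y \<in> cut_plane"
  shows "(power_mixture \<sigma> has_field_derivative
    (\<integral>\<omega>. of_real \<sigma> * of_real (X \<omega>) * (1 - y * of_real (X \<omega>)) powr (- of_real \<sigma> - 1) \<partial>M)) (at y)"
proof -
  define k where "k = (\<lambda>z x. (1 - z * complex_of_real x) powr (- of_real \<sigma>))"
  define k' where "k' = (\<lambda>z x. of_real \<sigma> * complex_of_real x * (1 - z * of_real x) powr (- of_real \<sigma> - 1))"
  have der: "((\<lambda>z. k z x) has_field_derivative k' z x) (at z)" if "z \<in> cut_plane" "0 \<le> x" "x \<le> 1" for z x
    unfolding k_def k'_def using one_minus_cut_plane[OF that]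
    by (auto intro!: derivative_eq_intros simp: algebra_simps)
  obtain r where r: "0 < r" "cball y r \<subseteq> cut_plane"
    using open_cut_plane y open_contains_cball by blast
  have "continuous_on (cball y r \<times> {0..1}) (\<lambda>w. k' (fst w) (snd w))"
    unfolding k'_def using one_minus_cut_plane r(2) by (intro continuous_on_powr_slit continuous_intros) auto
  then have "bounded ((\<lambda>w. k' (fst w) (snd w)) ` (cball y r \<times> {0..1}))"
    by (intro compact_imp_bounded compact_continuous_image compact_Times) auto
  then obtain B where B: "\<forall>z\<in>cball y r. \<forall>x\<in>{0..1}. norm (k' z x) \<le> B"
    by (fastforce simp: bounded_iff)
  have lip: "norm (k z x - k y x) \<le> B * norm (z - y)" if z: "z \<in> cball y r" and x: "0 \<le> x" "x \<le> 1" for z x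
  proof (rule field_differentiable_bound[of "cball y r" "\<lambda>z. k z x" "\<lambda>z. k' z x"])
    show "((\<lambda>z. k z x) has_field_derivative k' w x) (at w within cball y r)" if "w \<in> cball y r" for w
      by (rule has_field_derivative_at_within[OF der[OF subsetD[OF r(2) that] x]])
    show "norm (k' w x) \<le> B" if "w \<in> cball y r" for w using B that x by simp
  qed (use r z in auto)
  have k_int: "integrable M (\<lambda>\<omega>. k z (X \<omega>))" if "z \<in> cut_plane" for z
    unfolding k_def by (rule integrable_continuous[OF continuous_power_kernel[OF that]])
  have k'_int: "integrable M (\<lambda>\<omega>. k' y (X \<omega>))"
    unfolding k'_def by (intro integrable_continuous[of "\<lambda>x. of_real \<sigma> * of_real x * (1 - y * of_real x) powr (- of_real \<sigma> - 1)"]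
      continuous_intros continuous_power_kernel y)
  have "((\<lambda>z. (power_mixture \<sigma> z - power_mixture \<sigma> y) / (z - y)) \<longlongrightarrow> (\<integral>\<omega>. k' y (X \<omega>) \<partial>M)) (at y)"
    unfolding tendsto_at_iff_sequentially
  proof (intro allI impI)
    fix Z :: "nat \<Rightarrow> complex" assume Z: "\<forall>i. Z i \<in> UNIV - {y}" "Z \<longlonglongrightarrow> y"
    have "eventually (\<lambda>i. Z i \<in> ball y r) sequentially"
      using Z(2) r(1) by (auto simp: tendsto_iff dist_commute)
    then obtain i0 where i0: "\<And>i. i0 \<le> i \<Longrightarrow> Z i \<in> ball y r" by (auto simp: eventually_sequentially)
    define W where "W = (\<lambda>i. Z (i + i0))"
    have W: "W i \<in> cball y r" "W i \<noteq> y" for i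
      using i0[of "i + i0"] Z(1) by (auto simp: W_def)
    have Wy: "W \<longlonglongrightarrow> y" unfolding W_def by (rule LIMSEQ_ignore_initial_segment[OF Z(2)])
    define s where "s = (\<lambda>i \<omega>. (k (W i) (X \<omega>) - k y (X \<omega>)) / (W i - y))"
    have s_int: "integrable M (s i)" for i
      unfolding s_def using W(1)[of i] r y by (intro integrable_divide_zero Bochner_Integration.integrable_diff k_int) auto
    have "(\<lambda>i. integral\<^sup>L M (s i)) \<longlonglongrightarrow> (\<integral>\<omega>. k' y (X \<omega>) \<partial>M)"
    proof (rule integral_dominated_convergence[where w = "\<lambda>_. B"])
      show "AE \<omega> in M. (\<lambda>i. s i \<omega>) \<longlonglongrightarrow> k' y (X \<omega>)"
      proof (rule AE_I2)
        fix \<omega>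
        have "((\<lambda>z. (k z (X \<omega>) - k y (X \<omega>)) / (z - y)) \<longlongrightarrow> k' y (X \<omega>)) (at y)"
          using der[OF y, of "X \<omega>"] X_pos[of \<omega>] X_le[of \<omega>] by (simp add: has_field_derivative_iff)
        moreover have "filterlim W (at y) sequentially"
          using Wy W(2) by (simp add: filterlim_at)
        ultimately show "(\<lambda>i. s i \<omega>) \<longlonglongrightarrow> k' y (X \<omega>)"
          unfolding s_def by (rule filterlim_compose)
      qed
      show "AE \<omega> in M. norm (s i \<omega>) \<le> B" for i
      proof (rule AE_I2)
        fix \<omega>
        have "0 < norm (W i - y)" using W(2)[of i] by simp
        then show "norm (s i \<omega>) \<le> B"
          using lip[OF W(1)[of i], of "X \<omega>"] X_pos[of \<omega>] X_le[of \<omega>]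
          by (simp add: s_def norm_divide pos_divide_le_eq)
      qed
    qed (use s_int k'_int in auto)
    moreover have "integral\<^sup>L M (s i) = (power_mixture \<sigma> (W i) - power_mixture \<sigma> y) / (W i - y)" for i
    proof -
      have "W i \<in> cut_plane" using W(1)[of i] r(2) by blast
      then have "(\<integral>\<omega>. k (W i) (X \<omega>) - k y (X \<omega>) \<partial>M) = power_mixture \<sigma> (W i) - power_mixture \<sigma> y"
        using Bochner_Integration.integral_diff[OF k_int k_int, of "W i" y] y
        by (simp add: power_mixture_def k_def)
      then show ?thesis unfolding s_def by simp
    qed
    ultimately have "(\<lambda>i. (power_mixture \<sigma> (Z (i + i0)) - power_mixture \<sigma> y) / (Z (i + i0) - y)) \<longlonglongrightarrow> (\<integral>\<omega>. k' y (X \<omega>) \<partial>M)"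
      by (simp add: W_def)
    then show "((\<lambda>z. (power_mixture \<sigma> z - power_mixture \<sigma> y) / (z - y)) \<circ> Z) \<longlonglongrightarrow> (\<integral>\<omega>. k' y (X \<omega>) \<partial>M)"
      unfolding o_def by (rule LIMSEQ_offset)
  qed
  then show ?thesis by (simp add: has_field_derivative_iff k'_def)
qed

lemma power_mixture_holomorphic: "power_mixture \<sigma> holomorphic_on cut_plane"
proof (rule holomorphic_onI)
  show "power_mixture \<sigma> field_differentiable at y within cut_plane" if "y \<in> cut_plane" for y
    using power_mixture_has_derivative[OF that] by (meson field_differentiable_at_within field_differentiable_def)
qed

text \<open>
  The mixture is holomorphic on the cut plane and has the right series, so a continuation exists,
  and any other one agrees with it by the identity theorem.
\<close>
lemma hypergeometric_eq_power_mixture: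
  assumes A: "A \<noteq> 0"
    and moments: "\<And>n. (\<integral>\<omega>. X \<omega> ^ n \<partial>M) = A * ((\<Prod>i=1..q. pochhammer (a i) n) / (\<Prod>i=1..q. pochhammer (b i) n))"
    and y: "y \<in> cut_plane"
  shows "hypergeometric q \<sigma> a b y = power_mixture \<sigma> y / of_real A"
proof -
  let ?P = "\<lambda>F. F holomorphic_on cut_plane \<and> (\<forall>y. norm y < 1 \<longrightarrow> F y = hyp_series q \<sigma> a b y)"
  let ?G = "\<lambda>y. power_mixture \<sigma> y / of_real A"
  have G: "?P ?G"
  proof (intro conjI allI impI)
    show "?G holomorphic_on cut_plane"
      using A by (intro holomorphic_intros power_mixture_holomorphic) auto
    fix y :: complex assume y: "norm y < 1"
    have "(\<lambda>n. of_real (pochhammer \<sigma> n * (\<integral>\<omega>. X \<omega> ^ n \<partial>M)) * y ^ n / fact n / of_real A) sums (power_mixture \<sigma> y / of_real A)"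
      by (intro sums_divide power_mixture_sums y)
    then have "(\<lambda>n. of_real (pochhammer \<sigma> n * (\<Prod>i=1..q. pochhammer (a i) n)
                     / (\<Prod>i=1..q. pochhammer (b i) n)) * y ^ n / fact n) sums (power_mixture \<sigma> y / of_real A)"
      unfolding moments using A by (simp add: field_simps)
    then show "?G y = hyp_series q \<sigma> a b y"
      unfolding hyp_series_def by (simp add: sums_iff)
  qed
  then have F: "?P (hypergeometric q \<sigma> a b)"
    unfolding hypergeometric_def by (rule someI[where P = ?P])
  show ?thesis
  proof (rule analytic_continuation_open[of "ball 0 1" cut_plane "hypergeometric q \<sigma> a b" ?G])
    show "ball 0 1 \<noteq> {}" by simp
    fix z :: complex assume "z \<in> ball 0 1"
    then show "hypergeometric q \<sigma> a b z = ?G z" using F G by simp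
  qed (use F G open_cut_plane connected_cut_plane unit_ball_cut_plane y in auto)
qed

end

section \<open>Monotonicity of the quotient\<close>

text \<open>
  Since \<open>m\<close> is the mean of \<open>f\<close> under the weight \<open>w\<close>, the constant \<open>\<gamma>\<close> drops out when the integral of
  \<open>w (f - m) (g - \<gamma>) \<ge> 0\<close> is expanded.
\<close>
lemma integral_chebyshev_inequality:
  fixes w f g :: "'a \<Rightarrow> real"
  assumes int: "integrable M w" "integrable M (\<lambda>\<omega>. w \<omega> * f \<omega>)" "integrable M (\<lambda>\<omega>. w \<omega> * g \<omega>)"
      "integrable M (\<lambda>\<omega>. w \<omega> * (f \<omega> * g \<omega>))"
    and w: "\<And>\<omega>. 0 \<le> w \<omega>"
    and mean: "(\<integral>\<omega>. w \<omega> * f \<omega> \<partial>M) = m * (\<integral>\<omega>. w \<omega> \<partial>M)"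
    and mono: "\<And>\<omega>. 0 \<le> (f \<omega> - m) * (g \<omega> - \<gamma>)"
  shows "m * (\<integral>\<omega>. w \<omega> * g \<omega> \<partial>M) \<le> (\<integral>\<omega>. w \<omega> * (f \<omega> * g \<omega>) \<partial>M)"
proof -
  have "0 \<le> (\<integral>\<omega>. w \<omega> * ((f \<omega> - m) * (g \<omega> - \<gamma>)) \<partial>M)"
    by (intro Bochner_Integration.integral_nonneg mult_nonneg_nonneg w mono)
  also have "(\<lambda>\<omega>. w \<omega> * ((f \<omega> - m) * (g \<omega> - \<gamma>))) =
     (\<lambda>\<omega>. (w \<omega> * (f \<omega> * g \<omega>) - m * (w \<omega> * g \<omega>)) - \<gamma> * (w \<omega> * f \<omega> - m * w \<omega>))"
    by (rule ext) (simp add: algebra_simps)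
  also have "(\<integral>\<omega>. (w \<omega> * (f \<omega> * g \<omega>) - m * (w \<omega> * g \<omega>)) - \<gamma> * (w \<omega> * f \<omega> - m * w \<omega>) \<partial>M) =
     ((\<integral>\<omega>. w \<omega> * (f \<omega> * g \<omega>) \<partial>M) - m * (\<integral>\<omega>. w \<omega> * g \<omega> \<partial>M)) - \<gamma> * ((\<integral>\<omega>. w \<omega> * f \<omega> \<partial>M) - m * (\<integral>\<omega>. w \<omega> \<partial>M))"
    using int by simp
  finally show ?thesis by (simp add: mean)
qed

lemma one_plus_pos: "- 1 < t \<Longrightarrow> 0 \<le> x \<Longrightarrow> x \<le> 1 \<Longrightarrow> 0 < 1 + t * x" for t x :: real
proof (cases "0 \<le> t")
  case False
  assume "- 1 < t" "0 \<le> x" "x \<le> 1"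
  then have "t * 1 \<le> t * x" using False by (intro mult_left_mono_neg) auto
  then show "0 < 1 + t * x" using \<open>- 1 < t\<close> by linarith
qed (simp add: add_pos_nonneg)

context unit_interval_variable
begin

lemma unit_interval_variable_density:
  assumes "0 < \<delta>"
  shows "unit_interval_variable (density M (\<lambda>\<omega>. ennreal (X \<omega> powr \<delta>))) X"
proof (intro unit_interval_variable.intro finite_measureI unit_interval_variable_axioms.intro X_pos X_le)
  let ?N = "density M (\<lambda>\<omega>. ennreal (X \<omega> powr \<delta>))"
  have "emeasure ?N (space ?N) = (\<integral>\<^sup>+ \<omega>. ennreal (X \<omega> powr \<delta>) \<partial>M)"
    by (subst emeasure_density) (auto intro!: nn_integral_cong)
  also have "\<dots> \<le> (\<integral>\<^sup>+ \<omega>. 1 \<partial>M)"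
    using X_pos X_le assms by (intro nn_integral_mono) (simp add: powr_le1 less_imp_le)
  also have "\<dots> < \<infinity>" by (simp add: emeasure_eq_measure)
  finally show "emeasure ?N (space ?N) \<noteq> \<infinity>" by simp
qed measurable

lemma integral_density_powr:
  fixes h :: "real \<Rightarrow> 'c :: {banach, second_countable_topology}"
  assumes "continuous_on {0..1} h"
  shows "(\<integral>\<omega>. h (X \<omega>) \<partial>density M (\<lambda>\<omega>. ennreal (X \<omega> powr \<delta>))) = (\<integral>\<omega>. X \<omega> powr \<delta> *\<^sub>R h (X \<omega>) \<partial>M)"
  using borel_measurable_integrable[OF integrable_continuous[OF assms]]
  by (intro integral_density) auto

lemma power_kernel_of_real:
  assumes "- 1 < t" "0 \<le> x" "x \<le> 1"
  shows "(1 - of_real (- t) * of_real x) powr (of_real s) = complex_of_real ((1 + t * x) powr s)"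
proof -
  have "(1 - of_real (- t) * of_real x) = complex_of_real (1 + t * x)" by simp
  then show ?thesis using one_plus_pos[OF assms] by (simp only: powr_of_real less_imp_le)
qed

lemma power_mixture_of_real:
  assumes "- 1 < t"
  shows "power_mixture \<sigma> (of_real (- t)) = of_real (\<integral>\<omega>. (1 + t * X \<omega>) powr (- \<sigma>) \<partial>M)"
proof -
  have "(1 - of_real (- t) * of_real (X \<omega>)) powr (- of_real \<sigma>) = complex_of_real ((1 + t * X \<omega>) powr (- \<sigma>))" for \<omega>
    using power_kernel_of_real[OF assms, of "X \<omega>" "- \<sigma>"] X_pos[of \<omega>] X_le[of \<omega>] by simp
  then show ?thesis unfolding power_mixture_def by (simp only: integral_complex_of_real)
qed

lemma power_mixture_derivative_of_real:
  assumes t: "- 1 < t"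
  shows "(power_mixture \<sigma> has_field_derivative
    of_real (\<sigma> * (\<integral>\<omega>. (1 + t * X \<omega>) powr (- \<sigma>) * (X \<omega> / (1 + t * X \<omega>)) \<partial>M))) (at (of_real (- t)))"
proof -
  have k: "of_real \<sigma> * of_real (X \<omega>) * (1 - of_real (- t) * of_real (X \<omega>)) powr (- of_real \<sigma> - 1)
     = complex_of_real (\<sigma> * ((1 + t * X \<omega>) powr (- \<sigma>) * (X \<omega> / (1 + t * X \<omega>))))" for \<omega>
  proof -
    have pos: "0 < 1 + t * X \<omega>" using one_plus_pos[OF t] X_pos[of \<omega>] X_le[of \<omega>] by (simp add: less_imp_le)
    have "(1 - of_real (- t) * of_real (X \<omega>)) powr (- of_real \<sigma> - 1) = complex_of_real ((1 + t * X \<omega>) powr (- \<sigma> - 1))"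
      using power_kernel_of_real[OF t, of "X \<omega>" "- \<sigma> - 1"] X_pos[of \<omega>] X_le[of \<omega>] by simp
    moreover have "(1 + t * X \<omega>) powr (- \<sigma> - 1) = (1 + t * X \<omega>) powr (- \<sigma>) / (1 + t * X \<omega>)"
      using pos by (simp add: powr_diff)
    ultimately show ?thesis by simp
  qed
  have "(\<integral>\<omega>. complex_of_real (\<sigma> * ((1 + t * X \<omega>) powr (- \<sigma>) * (X \<omega> / (1 + t * X \<omega>)))) \<partial>M) =
     of_real (\<sigma> * (\<integral>\<omega>. (1 + t * X \<omega>) powr (- \<sigma>) * (X \<omega> / (1 + t * X \<omega>)) \<partial>M))"
    by (simp only: integral_complex_of_real integral_mult_right_zero)
  moreover have "of_real (- t) \<in> cut_plane" using t unfolding of_real_in_cut_plane_iff by simp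
  ultimately show ?thesis using power_mixture_has_derivative[of "of_real (- t)" \<sigma>] unfolding k by simp
qed

text \<open>
  Chebyshev's inequality, with \<open>\<gamma>\<close> the value of the second function at the point \<open>t\<close> where the first
  one, \<open>X\<^sup>\<delta>\<close>, crosses its mean \<open>m\<close>: since both increase with \<open>X\<close>, they change sign together.
\<close>
lemma power_weighted_covariance:
  fixes x \<sigma> \<delta> :: real
  assumes x: "- 1 < x" and \<delta>: "0 < \<delta>"
  defines "w \<equiv> \<lambda>\<omega>. (1 + x * X \<omega>) powr (- \<sigma>)" and "g \<equiv> \<lambda>\<omega>. X \<omega> / (1 + x * X \<omega>)" and "f \<equiv> \<lambda>\<omega>. X \<omega> powr \<delta>"
  assumes W: "0 < (\<integral>\<omega>. w \<omega> \<partial>M)"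
  shows "(\<integral>\<omega>. f \<omega> * w \<omega> \<partial>M) * (\<integral>\<omega>. w \<omega> * g \<omega> \<partial>M) \<le> (\<integral>\<omega>. f \<omega> * (w \<omega> * g \<omega>) \<partial>M) * (\<integral>\<omega>. w \<omega> \<partial>M)"
proof -
  have pos: "0 < 1 + x * y" if "y \<in> {0..1}" for y using one_plus_pos[OF x] that by simp
  have nz: "\<forall>y\<in>{0..1}. 1 + x * y \<noteq> 0" using pos by force
  have cw: "continuous_on {0..1} (\<lambda>y. (1 + x * y) powr (- \<sigma>))"
    using nz by (intro continuous_intros) auto
  have cg: "continuous_on {0..1} (\<lambda>y. y / (1 + x * y))"
    using nz by (intro continuous_intros) auto
  have cf: "continuous_on {0..1} (\<lambda>y::real. y powr \<delta>)"
    using \<delta> by (intro continuous_on_powr' continuous_intros) auto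
  have int: "integrable M w" "integrable M (\<lambda>\<omega>. w \<omega> * f \<omega>)" "integrable M (\<lambda>\<omega>. w \<omega> * g \<omega>)"
      "integrable M (\<lambda>\<omega>. w \<omega> * (f \<omega> * g \<omega>))"
    unfolding w_def f_def g_def
    using integrable_continuous[OF cw] integrable_continuous[OF continuous_on_mult[OF cw cf]]
      integrable_continuous[OF continuous_on_mult[OF cw cg]]
      integrable_continuous[OF continuous_on_mult[OF cw continuous_on_mult[OF cf cg]]] by auto
  have w_nonneg: "0 \<le> w \<omega>" for \<omega> by (simp add: w_def)
  define m where "m = (\<integral>\<omega>. w \<omega> * f \<omega> \<partial>M) / (\<integral>\<omega>. w \<omega> \<partial>M)"
  have mean: "(\<integral>\<omega>. w \<omega> * f \<omega> \<partial>M) = m * (\<integral>\<omega>. w \<omega> \<partial>M)" using W by (simp add: m_def)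
  have f01: "0 \<le> f \<omega>" "f \<omega> \<le> 1" for \<omega>
    using X_pos[of \<omega>] X_le[of \<omega>] \<delta> by (auto simp: f_def intro!: powr_le1)
  have "(\<integral>\<omega>. w \<omega> * f \<omega> \<partial>M) \<le> (\<integral>\<omega>. w \<omega> \<partial>M)"
    using int w_nonneg f01 by (intro integral_mono) (auto simp: mult_left_le)
  moreover have "0 \<le> (\<integral>\<omega>. w \<omega> * f \<omega> \<partial>M)"
    using w_nonneg f01 by (intro Bochner_Integration.integral_nonneg) auto
  ultimately have m: "0 \<le> m" "m \<le> 1" using W by (auto simp: m_def)
  define t where "t = m powr (1 / \<delta>)"
  have t: "0 \<le> t" "t \<le> 1" "t powr \<delta> = m"
    using m \<delta> by (auto simp: t_def powr_powr intro!: powr_le1)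
  have g_mono: "y / (1 + x * y) \<le> z / (1 + x * z)" if "0 \<le> y" "y \<le> z" "z \<le> 1" for y z
    using pos[of y] pos[of z] that by (simp add: divide_simps algebra_simps)
  have mono: "0 \<le> (f \<omega> - m) * (g \<omega> - t / (1 + x * t))" for \<omega>
  proof (cases "t \<le> X \<omega>")
    case True
    then have "m \<le> f \<omega>" using t \<delta> powr_mono2[of \<delta> t "X \<omega>"] by (simp add: f_def)
    moreover have "t / (1 + x * t) \<le> g \<omega>" unfolding g_def by (rule g_mono[OF t(1) True X_le])
    ultimately show ?thesis by simp
  next
    case False
    then have "f \<omega> \<le> m" using X_pos[of \<omega>] t \<delta> powr_mono2[of \<delta> "X \<omega>" t] by (simp add: f_def)
    moreover have "g \<omega> \<le> t / (1 + x * t)" unfolding g_def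
      using False X_pos[of \<omega>] by (intro g_mono t) auto
    ultimately show ?thesis by (simp add: mult_nonpos_nonpos)
  qed
  have "m * (\<integral>\<omega>. w \<omega> * g \<omega> \<partial>M) \<le> (\<integral>\<omega>. w \<omega> * (f \<omega> * g \<omega>) \<partial>M)"
    by (rule integral_chebyshev_inequality[OF int w_nonneg mean mono])
  then have "(m * (\<integral>\<omega>. w \<omega> \<partial>M)) * (\<integral>\<omega>. w \<omega> * g \<omega> \<partial>M) \<le> (\<integral>\<omega>. w \<omega> * (f \<omega> * g \<omega>) \<partial>M) * (\<integral>\<omega>. w \<omega> \<partial>M)"
    using mult_right_mono[OF _ less_imp_le[OF W], of "m * (\<integral>\<omega>. w \<omega> * g \<omega> \<partial>M)" "\<integral>\<omega>. w \<omega> * (f \<omega> * g \<omega>) \<partial>M"]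
    by (simp add: mult_ac)
  then show ?thesis unfolding mean[symmetric] by (simp add: mult_ac)
qed

lemma power_mixture_real_pos:
  assumes t: "- 1 < t" and mass: "0 < measure M (space M)"
  shows "0 < (\<integral>\<omega>. (1 + t * X \<omega>) powr (- \<sigma>) \<partial>M)"
proof -
  let ?w = "\<lambda>\<omega>. (1 + t * X \<omega>) powr (- \<sigma>)"
  have pos: "0 < ?w \<omega>" for \<omega>
    using one_plus_pos[OF t, of "X \<omega>"] X_pos[of \<omega>] X_le[of \<omega>] by simp
  have "continuous_on {0..1} (\<lambda>y. (1 + t * y) powr (- \<sigma>))"
    using one_plus_pos[OF t] by (intro continuous_intros) force
  then have int: "integrable M ?w" by (rule integrable_continuous)
  have "\<not> (AE \<omega> in M. ?w \<omega> = 0)"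
  proof
    assume "AE \<omega> in M. ?w \<omega> = 0"
    then have "AE \<omega> in M. False" by (rule AE_mp) (use pos in \<open>auto simp: less_le\<close>)
    then have "emeasure M (space M) = 0" by (simp add: AE_iff_null_sets null_setsD1 eventually_False ae_filter_eq_bot_iff)
    then show False using mass by (simp add: measure_def)
  qed
  then have "integral\<^sup>L M ?w \<noteq> 0"
    using integral_nonneg_eq_0_iff_AE[OF int] pos by (simp add: less_imp_le)
  moreover have "0 \<le> integral\<^sup>L M ?w" using pos by (intro Bochner_Integration.integral_nonneg) (simp add: less_imp_le)
  ultimately show ?thesis by linarith
qed

end

theorem corollary3p1:
  fixes q :: nat and a b :: "nat \<Rightarrow> real" and \<delta> x \<sigma> :: real
  assumes "1 \<le> q"
    and "\<And>i. i \<in> {1..q} \<Longrightarrow> 0 < a i"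
    and "\<And>i. i \<in> {1..q} \<Longrightarrow> 0 < b i"
    and "(\<Sum>i=1..q. a i) \<le> (\<Sum>i=1..q. b i)"
    and "\<And>s. 0 < s \<Longrightarrow> s < 1 \<Longrightarrow> meijer_G q a b s \<in> \<real>\<^sub>\<ge>\<^sub>0"
    and "0 < \<delta>" and "- 1 < x"
  shows "hypergeometric q \<sigma> a b (of_real (- x)) \<noteq> 0 \<and>
    (\<exists>D :: real.
      ((\<lambda>t :: real. hypergeometric q \<sigma> (\<lambda>i. a i + \<delta>) (\<lambda>i. b i + \<delta>) (of_real (- t))
                    / hypergeometric q \<sigma> a b (of_real (- t)))
         has_vector_derivative of_real D) (at x) \<and>
      0 \<le> - sgn \<sigma> * D)"
proof -
  \<comment> \<open>Strictly between the rightmost pole and \<open>0\<close>.\<close>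
  define c where "c = - Min (a ` {1..q}) / 2"
  have "Min (a ` {1..q}) \<in> a ` {1..q}" using assms(1) by (intro Min_in) auto
  then have min_pos: "0 < Min (a ` {1..q})" using assms(2) by auto
  have min_le: "Min (a ` {1..q}) \<le> a i" if "i \<in> {1..q}" for i using that by simp
  interpret meijer_parameters q a b c
  proof
    show "c < 0" using min_pos by (simp add: c_def)
    show "0 < a i + c" if "i \<in> {1..q}" for i
      using min_le[OF that] min_pos unfolding c_def by linarith
  qed (use assms in auto)
  obtain M :: "real measure" and X where "unit_interval_variable M X"
    and moments: "\<forall>p\<ge>0. (\<integral>u. X u powr p \<partial>M) = gamma_ratio q a b p"
    by (rule mixing_measure[OF assms(5)])
  interpret M: unit_interval_variable M X by fact
  define N where "N = density M (\<lambda>u. ennreal (X u powr \<delta>))"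
  interpret N: unit_interval_variable N X
    unfolding N_def by (rule M.unit_interval_variable_density) fact
  let ?a' = "\<lambda>i. a i + \<delta>" and ?b' = "\<lambda>i. b i + \<delta>"
  define A where "A = gamma_ratio q a b (0 :: real)"
  define A' where "A' = gamma_ratio q a b \<delta>"
  have A: "0 < A"
    unfolding A_def by (rule gamma_ratio_pos) (simp_all only: add_0_right assms)
  have A': "0 < A'"
    unfolding A'_def by (rule gamma_ratio_pos) (simp_all add: add_pos_pos assms del: atLeastAtMost_iff)
  have X_power: "X u ^ n = X u powr real n" for u n using M.X_pos[of u] by (simp add: powr_realpow)
  have mom: "(\<integral>u. X u ^ n \<partial>M) = A * ((\<Prod>i=1..q. pochhammer (a i) n) / (\<Prod>i=1..q. pochhammer (b i) n))" for n
    unfolding X_power A_def using moments gamma_ratio_of_nat[OF assms(2,3), of q] by simp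
  have mom': "(\<integral>u. X u ^ n \<partial>N) = A' * ((\<Prod>i=1..q. pochhammer (?a' i) n) / (\<Prod>i=1..q. pochhammer (?b' i) n))" for n
  proof -
    have "(\<integral>u. X u ^ n \<partial>N) = (\<integral>u. X u powr \<delta> *\<^sub>R X u ^ n \<partial>M)"
      unfolding N_def by (rule M.integral_density_powr[of "\<lambda>y. y ^ n"]) (intro continuous_intros)
    also have "\<dots> = (\<integral>u. X u powr (\<delta> + real n) \<partial>M)"
      by (simp add: X_power powr_add)
    also have "\<dots> = gamma_ratio q ?a' ?b' (real n)"
      using moments assms(6) by (simp add: gamma_ratio_shift)
    also have "\<dots> = gamma_ratio q ?a' ?b' 0 * ((\<Prod>i=1..q. pochhammer (?a' i) n) / (\<Prod>i=1..q. pochhammer (?b' i) n))"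
      by (rule gamma_ratio_of_nat) (simp_all add: add_pos_pos assms del: atLeastAtMost_iff)
    also have "gamma_ratio q ?a' ?b' 0 = A'" by (simp add: gamma_ratio_shift A'_def)
    finally show ?thesis .
  qed
  have hyp: "hypergeometric q \<sigma> a b y = M.power_mixture \<sigma> y / of_real A" if "y \<in> cut_plane" for y
    using A by (intro M.hypergeometric_eq_power_mixture mom that) auto
  have hyp': "hypergeometric q \<sigma> ?a' ?b' y = N.power_mixture \<sigma> y / of_real A'" if "y \<in> cut_plane" for y
    using A' by (intro N.hypergeometric_eq_power_mixture mom' that) auto
  let ?w = "\<lambda>u. (1 + x * X u) powr (- \<sigma>)" and ?g = "\<lambda>u. X u / (1 + x * X u)"
  define W where "W = (\<integral>u. ?w u \<partial>M)"
  define V where "V = (\<integral>u. ?w u * ?g u \<partial>M)"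
  define W' where "W' = (\<integral>u. ?w u \<partial>N)"
  define V' where "V' = (\<integral>u. ?w u * ?g u \<partial>N)"
  have "measure M (space M) = A"
    using mom[of 0] by simp
  then have W: "0 < W" unfolding W_def using A by (intro M.power_mixture_real_pos assms) auto
  have nz: "\<forall>y\<in>{0..1}. 1 + x * y \<noteq> 0" using one_plus_pos[OF assms(7)] by force
  have W'_eq: "W' = (\<integral>u. X u powr \<delta> * ?w u \<partial>M)"
    unfolding W'_def N_def
    using M.integral_density_powr[of "\<lambda>y. (1 + x * y) powr (- \<sigma>)" \<delta>] nz by (simp add: continuous_intros)
  have V'_eq: "V' = (\<integral>u. X u powr \<delta> * (?w u * ?g u) \<partial>M)"
    unfolding V'_def N_def
    using M.integral_density_powr[of "\<lambda>y. (1 + x * y) powr (- \<sigma>) * (y / (1 + x * y))" \<delta>] nz by (simp add: continuous_intros)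
  have cov: "W' * V \<le> V' * W"
    unfolding W'_eq V'_eq V_def W_def
    by (rule M.power_weighted_covariance[OF assms(7,6)]) (use W in \<open>simp add: W_def\<close>)
  have mx: "of_real (- x) \<in> cut_plane" using assms(7) unfolding of_real_in_cut_plane_iff by simp
  have at_x: "M.power_mixture \<sigma> (of_real (- x)) = of_real W" "N.power_mixture \<sigma> (of_real (- x)) = of_real W'"
    unfolding W_def W'_def by (intro M.power_mixture_of_real N.power_mixture_of_real assms)+
  \<comment> \<open>The leading minus sign comes from \<open>y = - t\<close>.\<close>
  define D where "D = - (A / A' * (\<sigma> * V' * W - W' * (\<sigma> * V)) / (W * W))"
  have "((\<lambda>z. (N.power_mixture \<sigma> z / of_real A') / (M.power_mixture \<sigma> z / of_real A)) has_field_derivative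
      of_real (- D)) (at (of_real (- x)))"
  proof -
    have "((\<lambda>z. of_real (A / A') * (N.power_mixture \<sigma> z / M.power_mixture \<sigma> z)) has_field_derivative
      of_real (A / A') * ((of_real (\<sigma> * V') * of_real W - of_real W' * of_real (\<sigma> * V)) / (of_real W * of_real W))) (at (of_real (- x)))"
      using DERIV_divide[OF N.power_mixture_derivative_of_real[OF assms(7), of \<sigma>] M.power_mixture_derivative_of_real[OF assms(7), of \<sigma>]] W
      unfolding at_x V_def[symmetric] V'_def[symmetric] by (intro DERIV_cmult) auto
    moreover have "of_real (A / A') * ((of_real (\<sigma> * V') * of_real W - of_real W' * of_real (\<sigma> * V)) / (of_real W * of_real W)) = complex_of_real (- D)"
      by (simp add: D_def)
    moreover have "(\<lambda>z. of_real (A / A') * (N.power_mixture \<sigma> z / M.power_mixture \<sigma> z)) =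
      (\<lambda>z. (N.power_mixture \<sigma> z / of_real A') / (M.power_mixture \<sigma> z / of_real A))"
      by (simp add: mult.commute)
    ultimately show ?thesis by (simp only:)
  qed
  then have "((\<lambda>z. hypergeometric q \<sigma> ?a' ?b' z / hypergeometric q \<sigma> a b z) has_field_derivative of_real (- D)) (at (of_real (- x)))"
    by (rule has_field_derivative_transform_within_open[OF _ open_cut_plane mx]) (simp add: hyp hyp')
  then have "((\<lambda>z. hypergeometric q \<sigma> ?a' ?b' (- z) / hypergeometric q \<sigma> a b (- z)) has_field_derivative of_real (- D) * (- 1)) (at (of_real x))"
    by (intro DERIV_chain2[where f = "\<lambda>z. hypergeometric q \<sigma> ?a' ?b' z / hypergeometric q \<sigma> a b z"])
       (simp_all add: DERIV_minus[OF DERIV_ident])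
  then have "((\<lambda>t :: real. hypergeometric q \<sigma> ?a' ?b' (of_real (- t)) / hypergeometric q \<sigma> a b (of_real (- t)))
      has_vector_derivative of_real D) (at x)"
    using has_vector_derivative_real_field[of "\<lambda>z. hypergeometric q \<sigma> ?a' ?b' (- z) / hypergeometric q \<sigma> a b (- z)"] by simp
  moreover have "0 \<le> - sgn \<sigma> * D"
  proof -
    have "- sgn \<sigma> * D = (\<sigma> * sgn \<sigma>) * (A / A' * (V' * W - W' * V) / (W * W))"
      by (simp add: D_def algebra_simps diff_divide_distrib)
    also have "\<sigma> * sgn \<sigma> = \<bar>\<sigma>\<bar>" by (rule abs_sgn[symmetric])
    also have "0 \<le> \<bar>\<sigma>\<bar> * (A / A' * (V' * W - W' * V) / (W * W))"
      using A A' W cov by (intro mult_nonneg_nonneg divide_nonneg_nonneg) auto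
    finally show ?thesis .
  qed
  moreover have "hypergeometric q \<sigma> a b (of_real (- x)) \<noteq> 0"
    unfolding hyp[OF mx] at_x using W A by simp
  ultimately show ?thesis by blast
qed

end
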